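(* For every $r\ge 3$, there exists only one inclusion-wise minimal $r$-complete set (up to isomorphism of its members), i.e. $\mathcal H_r$ is unique.
   Context: All graphs are finite and may have parallel edges but no loops, and are considered up to isomorphism. For $X\subseteq V(G)$, $\partial_G(X)$ is the set of edges of $G$ with exactly one end in $X$; $\partial_G(v)=\partial_G(\{v\})$. An $r$-regular graph $G$ is an $r$-graph if $|\partial_G(X)|\ge r$ for every $X\subseteq V(G)$ of odd cardinality. An $H$-coloring of $G$ is a mapping $f\colon E(G)\to E(H)$ such that $f(e_1)\ne f(e_2)$ for adjacent edges $e_1,e_2$ of $G$, and for every $v\in V(G)$ there is $u\in V(H)$ with $f(\partial_G(v))=\partial_H(u)$. If such a mapping exists, $H$ is said to color $G$. A set $\mathcal A$ of connected $r$-graphs is $r$-complete if every connected $r$-graph $G$ is colored by some $H\in\mathcal A$. $\mathcal H_r$ denotes an inclusion-wise minimal $r$-complete set. *)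

theory Defs
  imports Main
begin

text \<open>Undirected multigraphs: an edge is a name carrying the set of its ends, so distinct edges
  may be parallel. The value of \<open>ends\<close> outside \<open>edges\<close> is irrelevant.\<close>

record ('v, 'e) mgraph =
  verts :: "'v set"
  edges :: "'e set"
  ends :: "'e \<Rightarrow> 'v set"

definition graph :: "('v, 'e) mgraph \<Rightarrow> bool" where
  "graph G \<longleftrightarrow> finite (verts G) \<and> finite (edges G) \<and>
     (\<forall>e\<in>edges G. ends G e \<subseteq> verts G \<and> card (ends G e) = 2)"

definition isomorphic :: "('v, 'e) mgraph \<Rightarrow> ('w, 'd) mgraph \<Rightarrow> bool" where
  "isomorphic G H \<longleftrightarrow> (\<exists>\<alpha> \<beta>. bij_betw \<alpha> (verts G) (verts H) \<and> bij_betw \<beta> (edges G) (edges H) \<and>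
     (\<forall>e\<in>edges G. ends H (\<beta> e) = \<alpha> ` ends G e))"

definition boundary :: "('v, 'e) mgraph \<Rightarrow> 'v set \<Rightarrow> 'e set" where
  "boundary G X = {e \<in> edges G. card (ends G e \<inter> X) = 1}"

definition adjacency :: "('v, 'e) mgraph \<Rightarrow> ('v \<times> 'v) set" where
  "adjacency G = {(u, v). \<exists>e\<in>edges G. ends G e = {u, v}}"

definition connected_graph :: "('v, 'e) mgraph \<Rightarrow> bool" where
  "connected_graph G \<longleftrightarrow> verts G \<noteq> {} \<and> (\<forall>u\<in>verts G. \<forall>v\<in>verts G. (u, v) \<in> (adjacency G)\<^sup>*)"

text \<open>As there are no loops, the degree of \<open>v\<close> is the size of the boundary of \<open>{v}\<close>.\<close>

definition regular_graph :: "nat \<Rightarrow> ('v, 'e) mgraph \<Rightarrow> bool" where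
  "regular_graph r G \<longleftrightarrow> graph G \<and> (\<forall>v\<in>verts G. card (boundary G {v}) = r)"

definition r_graph :: "nat \<Rightarrow> ('v, 'e) mgraph \<Rightarrow> bool" where
  "r_graph r G \<longleftrightarrow> regular_graph r G \<and>
     (\<forall>X. X \<subseteq> verts G \<and> odd (card X) \<longrightarrow> r \<le> card (boundary G X))"

definition adjacent_edges :: "('v, 'e) mgraph \<Rightarrow> 'e \<Rightarrow> 'e \<Rightarrow> bool" where
  "adjacent_edges G e e' \<longleftrightarrow> e \<in> edges G \<and> e' \<in> edges G \<and> e \<noteq> e' \<and> ends G e \<inter> ends G e' \<noteq> {}"

definition coloring :: "('w, 'd) mgraph \<Rightarrow> ('v, 'e) mgraph \<Rightarrow> ('e \<Rightarrow> 'd) \<Rightarrow> bool" where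
  "coloring H G f \<longleftrightarrow> f ` edges G \<subseteq> edges H \<and>
     (\<forall>e e'. adjacent_edges G e e' \<longrightarrow> f e \<noteq> f e') \<and>
     (\<forall>v\<in>verts G. \<exists>u\<in>verts H. f ` boundary G {v} = boundary H {u})"

definition colors :: "('w, 'd) mgraph \<Rightarrow> ('v, 'e) mgraph \<Rightarrow> bool" where
  "colors H G \<longleftrightarrow> (\<exists>f. coloring H G f)"

text \<open>Sets of graphs need a single type of graphs. Natural numbers as vertices and edges suffice,
  since every finite graph has an isomorphic copy of this type.\<close>

type_synonym nat_graph = "(nat, nat) mgraph"

lemma ex_isomorphic_nat_graph:
  fixes G :: "('v, 'e) mgraph"
  assumes "graph G"
  shows "\<exists>H :: nat_graph. graph H \<and> isomorphic G H"
proof -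
  have fin: "finite (verts G)" "finite (edges G)"
    and ends: "\<And>e. e \<in> edges G \<Longrightarrow> ends G e \<subseteq> verts G \<and> card (ends G e) = 2"
    using assms by (auto simp: graph_def)
  obtain a :: "'v \<Rightarrow> nat" where a: "inj_on a (verts G)"
    using finite_imp_inj_to_nat_seg[OF fin(1)] by blast
  obtain b :: "'e \<Rightarrow> nat" where b: "inj_on b (edges G)"
    using finite_imp_inj_to_nat_seg[OF fin(2)] by blast
  define H :: nat_graph where
    "H = \<lparr>verts = a ` verts G, edges = b ` edges G,
          ends = (\<lambda>d. a ` ends G (inv_into (edges G) b d))\<rparr>"
  have E: "ends H (b e) = a ` ends G e" if "e \<in> edges G" for e
    using that b by (simp add: H_def)
  have "graph H"
    unfolding graph_def
  proof (intro conjI ballI)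
    show "finite (verts H)" "finite (edges H)"
      using fin by (simp_all add: H_def)
  next
    fix d assume "d \<in> edges H"
    then obtain e where e: "e \<in> edges G" "d = b e" by (auto simp: H_def)
    show "ends H d \<subseteq> verts H"
      using E[OF e(1)] ends[OF e(1)] e(2) by (auto simp: H_def)
    show "card (ends H d) = 2"
      using E[OF e(1)] ends[OF e(1)] e(2) card_image[OF inj_on_subset[OF a]] by simp
  qed
  moreover have "isomorphic G H"
    unfolding isomorphic_def
    using a b E by (intro exI[of _ a] exI[of _ b]) (auto simp: H_def bij_betw_def)
  ultimately show ?thesis by blast
qed

definition r_complete :: "nat \<Rightarrow> nat_graph set \<Rightarrow> bool" where
  "r_complete r \<A> \<longleftrightarrow> (\<forall>H\<in>\<A>. connected_graph H \<and> r_graph r H) \<and>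
     (\<forall>G :: nat_graph. connected_graph G \<and> r_graph r G \<longrightarrow> (\<exists>H\<in>\<A>. colors H G))"

definition minimal_r_complete :: "nat \<Rightarrow> nat_graph set \<Rightarrow> bool" where
  "minimal_r_complete r \<A> \<longleftrightarrow> r_complete r \<A> \<and> (\<forall>\<B>. \<B> \<subset> \<A> \<longrightarrow> \<not> r_complete r \<B>)"

text \<open>Equality of sets of graphs considered up to isomorphism. Asking for a bijection loses nothing
  here: a minimal complete set never contains two isomorphic graphs.\<close>

definition same_up_to_iso :: "nat_graph set \<Rightarrow> nat_graph set \<Rightarrow> bool" where
  "same_up_to_iso \<A> \<B> \<longleftrightarrow> (\<exists>\<phi>. bij_betw \<phi> \<A> \<B> \<and> (\<forall>G\<in>\<A>. isomorphic G (\<phi> G)))"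

end

theory Submission
  imports Defs
begin

text \<open>Write \<open>H \<le> G\<close> if \<open>H\<close> colors \<open>G\<close>. Colorings compose, so this is a preorder on connected
  \<open>r\<close>-graphs. A unique minimal complete set exists as soon as every graph lies above a graph \<open>M\<close>
  that is rigid, i.e. only isomorphic copies of \<open>M\<close> color \<open>M\<close>: a complete set must contain a
  copy of every rigid graph, and one copy of each of them suffices.

  Call \<open>M\<close> a core if it has more than two vertices and no connected \<open>r\<close>-graph with fewer vertices
  colors it. Cores are rigid (\<open>isomorphic_if_colors_core\<close>). Let \<open>H\<close> color \<open>M\<close>. A
  coloring induces a map \<open>\<phi>\<close> of the vertices that carries the star at \<open>v\<close> bijectively to the star
  at \<open>\<phi> v\<close>. If \<open>\<phi>\<close> is surjective, then \<open>H\<close> has at most, hence exactly, as many vertices as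
  \<open>M\<close>, and \<open>\<phi>\<close> is an isomorphism. Otherwise all fibres of \<open>\<phi>\<close> are even
  (\<open>card_image_le_half\<close>), so the image \<open>U\<close> has at most half as many vertices as \<open>M\<close>. Contract
  the rest of \<open>H\<close> to one vertex \<open>x\<close> and split off pairs of edges at \<open>x\<close>, keeping all odd cuts at
  size at least \<open>r\<close>, until \<open>x\<close> has degree \<open>r\<close> or \<open>0\<close> (\<open>rooted_r_graph_completion\<close>). The stars
  at \<open>U\<close> survive, so the resulting \<open>r\<close>-graph still colors \<open>M\<close>; it has at most \<open>|U| + 1\<close>
  vertices, fewer than \<open>M\<close>, a contradiction.

  Every graph lies above a core (\<open>ex_core_coloring\<close>). A smallest graph coloring \<open>G\<close> is a core or
  consists of \<open>r\<close> parallel edges. The latter graph is colored by everything, hence by any core,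
  so it remains to see that there is one. This is where \<open>r \<ge> 3\<close>
  enters: the Petersen graph with \<open>r - 2\<close> parallel copies of each spoke is an \<open>r\<close>-graph that is
  not \<open>r\<close>-edge-colorable, so a smallest graph coloring it has more than two vertices.\<close>

section \<open>Cuts and degrees\<close>

lemma boundary_singleton: "boundary G {v} = {e \<in> edges G. v \<in> ends G e}"
proof -
  have "card (A \<inter> {v}) = 1 \<longleftrightarrow> v \<in> A" for A
    by (cases "v \<in> A") simp_all
  then show ?thesis by (simp add: boundary_def)
qed

lemma boundary_subset_edges: "boundary G X \<subseteq> edges G"
  by (auto simp: boundary_def)

lemma graph_edge_ends:
  assumes "graph G" "e \<in> edges G"
  obtains p q where "ends G e = {p, q}" "p \<noteq> q" "p \<in> verts G" "q \<in> verts G"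
  using assms unfolding graph_def card_2_iff by (metis insert_subset)

lemma graph_edge_at:
  assumes "graph G" "e \<in> boundary G {v}"
  obtains w where "ends G e = {v, w}" "v \<noteq> w" "v \<in> verts G" "w \<in> verts G"
proof -
  from assms(2) have e: "e \<in> edges G" "v \<in> ends G e" by (auto simp: boundary_singleton)
  obtain p q where "ends G e = {p, q}" "p \<noteq> q" "p \<in> verts G" "q \<in> verts G"
    using graph_edge_ends[OF assms(1) e(1)] .
  with e(2) that show thesis by (auto simp: insert_commute)
qed

lemma finite_boundary: "graph G \<Longrightarrow> finite (boundary G X)"
  by (auto simp: graph_def boundary_def)

lemma pair_cut_iff:
  assumes "p \<noteq> q"
  shows "card ({p, q} \<inter> X) = 1 \<longleftrightarrow> (p \<in> X) \<noteq> (q \<in> X)"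
  using assms by (cases "p \<in> X"; cases "q \<in> X") auto

lemma mem_boundary_pair:
  assumes "e \<in> edges G" "ends G e = {p, q}" "p \<noteq> q"
  shows "e \<in> boundary G X \<longleftrightarrow> (p \<in> X) \<noteq> (q \<in> X)"
  using assms pair_cut_iff[of p q X] by (simp add: boundary_def)

lemma card_boundary_sum:
  assumes "graph G"
  shows "card (boundary G X) = (\<Sum>e\<in>edges G. of_bool (card (ends G e \<inter> X) = 1))"
  using assms by (simp add: boundary_def graph_def Int_def)

text \<open>Counting incidences in two ways: the edges inside \<open>X\<close> contribute twice to the degree
  sum, the cut edges once.\<close>

lemma even_card_boundary:
  assumes G: "graph G" and X: "X \<subseteq> verts G"
    and deg: "\<And>v. v \<in> X \<Longrightarrow> card (boundary G {v}) = r"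
  shows "even (card (boundary G X)) \<longleftrightarrow> even (r * card X)"
proof -
  have fin: "finite X" "finite (edges G)"
    using G X finite_subset by (auto simp: graph_def)
  have "r * card X = (\<Sum>v\<in>X. card (boundary G {v}))"
    using deg by simp
  also have "\<dots> = (\<Sum>v\<in>X. \<Sum>e\<in>edges G. of_bool (v \<in> ends G e))"
    using fin by (intro sum.cong) (simp_all add: boundary_singleton Int_def)
  also have "\<dots> = (\<Sum>e\<in>edges G. \<Sum>v\<in>X. of_bool (v \<in> ends G e))"
    by (rule sum.swap)
  also have "\<dots> = (\<Sum>e\<in>edges G. card (ends G e \<inter> X))"
    using fin by (intro sum.cong) (simp_all add: Int_def conj_commute)
  also have "even \<dots> \<longleftrightarrow> even (\<Sum>e\<in>edges G. of_bool (card (ends G e \<inter> X) = 1) :: nat)"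
  proof -
    have "even (card (ends G e \<inter> X) + of_bool (card (ends G e \<inter> X) = 1))" if "e \<in> edges G" for e
    proof -
      obtain p q where "ends G e = {p, q}" "p \<noteq> q"
        using graph_edge_ends[OF G \<open>e \<in> edges G\<close>] .
      then show ?thesis
        by (cases "p \<in> X"; cases "q \<in> X") simp_all
    qed
    then have "even (\<Sum>e\<in>edges G. card (ends G e \<inter> X) + of_bool (card (ends G e \<inter> X) = 1))"
      by (rule dvd_sum)
    then show ?thesis by (simp add: sum.distrib)
  qed
  finally show ?thesis by (simp add: card_boundary_sum[OF G])
qed

lemma boundary_complement:
  assumes "graph G" "X \<subseteq> verts G"
  shows "boundary G (verts G - X) = boundary G X"
proof -
  have "card (ends G e \<inter> (verts G - X)) = 1 \<longleftrightarrow> card (ends G e \<inter> X) = 1" if "e \<in> edges G" for e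
  proof -
    obtain p q where pq: "ends G e = {p, q}" "p \<noteq> q" "p \<in> verts G" "q \<in> verts G"
      using graph_edge_ends[OF assms(1) \<open>e \<in> edges G\<close>] .
    show ?thesis unfolding pq(1) pair_cut_iff[OF pq(2)] using pq(3,4) by auto
  qed
  then show ?thesis by (auto simp: boundary_def)
qed

lemma card_boundary_submodular:
  assumes G: "graph G"
  shows "card (boundary G (Y \<inter> Z)) + card (boundary G (Y \<union> Z))
    \<le> card (boundary G Y) + card (boundary G Z)"
proof -
  have "of_bool (card (ends G e \<inter> (Y \<inter> Z)) = 1) + of_bool (card (ends G e \<inter> (Y \<union> Z)) = 1)
    \<le> of_bool (card (ends G e \<inter> Y) = 1) + (of_bool (card (ends G e \<inter> Z) = 1) :: nat)"
    if "e \<in> edges G" for e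
  proof -
    obtain p q where pq: "ends G e = {p, q}" "p \<noteq> q"
      using graph_edge_ends[OF G \<open>e \<in> edges G\<close>] .
    show ?thesis unfolding pq(1) pair_cut_iff[OF pq(2)] by auto
  qed
  then show ?thesis
    unfolding card_boundary_sum[OF G] sum.distrib[symmetric] by (intro sum_mono)
qed

text \<open>The difference form of submodularity loses every edge between \<open>Y \<inter> Z\<close> and the outside of
  \<open>Y \<union> Z\<close>; a single such edge makes it strict.\<close>

lemma card_boundary_posimodular_strict:
  assumes G: "graph G" and d: "d \<in> edges G" "ends G d = {u, x}"
    and u: "u \<in> Y \<inter> Z" and x: "x \<notin> Y \<union> Z"
  shows "card (boundary G (Y - Z)) + card (boundary G (Z - Y))
    < card (boundary G Y) + card (boundary G Z)"
proof -
  let ?L = "\<lambda>e. of_bool (card (ends G e \<inter> (Y - Z)) = 1) + of_bool (card (ends G e \<inter> (Z - Y)) = 1) :: nat"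
  let ?R = "\<lambda>e. of_bool (card (ends G e \<inter> Y) = 1) + of_bool (card (ends G e \<inter> Z) = 1) :: nat"
  have "?L e \<le> ?R e" if "e \<in> edges G" for e
  proof -
    obtain p q where pq: "ends G e = {p, q}" "p \<noteq> q"
      using graph_edge_ends[OF G \<open>e \<in> edges G\<close>] .
    show ?thesis unfolding pq(1) pair_cut_iff[OF pq(2)] by auto
  qed
  moreover have "?L d < ?R d"
  proof -
    have "u \<noteq> x" using u x by auto
    then show ?thesis using d(2) u x by (simp add: pair_cut_iff)
  qed
  moreover have "finite (edges G)" using G by (simp add: graph_def)
  ultimately have "sum ?L (edges G) < sum ?R (edges G)"
    using d(1) by (intro sum_strict_mono_ex1) blast+
  then show ?thesis by (simp only: card_boundary_sum[OF G] sum.distrib)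
qed


section \<open>Colorings as local bijections\<close>

text \<open>The vertex map \<open>\<phi>\<close> that a coloring leaves implicit is made explicit here. It carries the
  adjacency and fibre arguments below, and local bijections visibly compose.\<close>

definition local_bijection ::
    "('v, 'e) mgraph \<Rightarrow> ('w, 'd) mgraph \<Rightarrow> ('e \<Rightarrow> 'd) \<Rightarrow> ('v \<Rightarrow> 'w) \<Rightarrow> bool" where
  "local_bijection G H f \<phi> \<longleftrightarrow>
     (\<forall>v\<in>verts G. \<phi> v \<in> verts H \<and> bij_betw f (boundary G {v}) (boundary H {\<phi> v}))"

lemma coloring_iff_local_bijection:
  assumes G: "graph G"
  shows "coloring H G f \<longleftrightarrow> (\<exists>\<phi>. local_bijection G H f \<phi>)"
proof
  assume f: "coloring H G f"
  have "\<exists>u. u \<in> verts H \<and> bij_betw f (boundary G {v}) (boundary H {u})" if "v \<in> verts G" for v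
  proof -
    obtain u where "u \<in> verts H" "f ` boundary G {v} = boundary H {u}"
      using f \<open>v \<in> verts G\<close> unfolding coloring_def by blast
    moreover have "inj_on f (boundary G {v})"
    proof (rule inj_onI, rule ccontr)
      fix e e' assume e: "e \<in> boundary G {v}" "e' \<in> boundary G {v}" "f e = f e'" "e \<noteq> e'"
      then have "adjacent_edges G e e'"
        by (auto simp: adjacent_edges_def boundary_singleton)
      with f e(3) show False by (auto simp: coloring_def)
    qed
    ultimately show ?thesis by (auto simp: bij_betw_def)
  qed
  then show "\<exists>\<phi>. local_bijection G H f \<phi>"
    unfolding local_bijection_def by metis
next
  assume "\<exists>\<phi>. local_bijection G H f \<phi>"
  then obtain \<phi> where \<phi>: "local_bijection G H f \<phi>" ..
  have at: "inj_on f (boundary G {v})" "f ` boundary G {v} = boundary H {\<phi> v}" "\<phi> v \<in> verts H"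
    if "v \<in> verts G" for v
    using \<phi> that by (auto simp: local_bijection_def bij_betw_def)
  show "coloring H G f"
    unfolding coloring_def
  proof (intro conjI allI impI ballI)
    show "f ` edges G \<subseteq> edges H"
    proof
      fix d assume "d \<in> f ` edges G"
      then obtain e where e: "e \<in> edges G" "d = f e" by blast
      obtain p q where "ends G e = {p, q}" "p \<in> verts G" using graph_edge_ends[OF G e(1)] by metis
      with e at(2)[of p] show "d \<in> edges H" by (auto simp: boundary_singleton)
    qed
    fix e e' assume adj: "adjacent_edges G e e'"
    then obtain v where v: "v \<in> ends G e" "v \<in> ends G e'" and e: "e \<in> edges G" "e' \<in> edges G" "e \<noteq> e'"
      by (auto simp: adjacent_edges_def)
    have "v \<in> verts G" using G e v by (auto simp: graph_def)
    with at(1) e v show "f e \<noteq> f e'" by (auto simp: inj_on_def boundary_singleton)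
  qed (use at in blast)
qed

lemma colors_iff_local_bijection:
  "graph G \<Longrightarrow> colors H G \<longleftrightarrow> (\<exists>f \<phi>. local_bijection G H f \<phi>)"
  by (simp add: colors_def coloring_iff_local_bijection)

lemma local_bijection_comp:
  assumes "local_bijection G H f \<phi>" "local_bijection H K g \<psi>"
  shows "local_bijection G K (g \<circ> f) (\<psi> \<circ> \<phi>)"
  unfolding local_bijection_def
proof (intro ballI conjI)
  fix v assume v: "v \<in> verts G"
  with assms show "(\<psi> \<circ> \<phi>) v \<in> verts K" by (simp add: local_bijection_def)
  have "bij_betw f (boundary G {v}) (boundary H {\<phi> v})"
    "bij_betw g (boundary H {\<phi> v}) (boundary K {\<psi> (\<phi> v)})"
    using assms v by (simp_all add: local_bijection_def)
  then show "bij_betw (g \<circ> f) (boundary G {v}) (boundary K {(\<psi> \<circ> \<phi>) v})"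
    using bij_betw_trans by fastforce
qed

lemma colors_trans:
  assumes "graph G" "graph H" "colors H G" "colors K H"
  shows "colors K G"
proof -
  obtain f \<phi> g \<psi> where "local_bijection G H f \<phi>" "local_bijection H K g \<psi>"
    using assms by (auto simp: colors_iff_local_bijection)
  from local_bijection_comp[OF this] show ?thesis
    using assms(1) by (auto simp: colors_iff_local_bijection)
qed

lemma colors_refl: "graph G \<Longrightarrow> colors G G"
  unfolding colors_iff_local_bijection local_bijection_def
  by (rule exI[of _ id], rule exI[of _ id]) simp

lemma local_bijection_edge:
  assumes G: "graph G" and f: "local_bijection G H f \<phi>" and e: "e \<in> edges G"
  shows "f e \<in> edges H" "\<phi> ` ends G e \<subseteq> ends H (f e)"
proof -
  have *: "f e \<in> edges H \<and> \<phi> v \<in> ends H (f e)" if "v \<in> ends G e" for v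
  proof -
    have "v \<in> verts G" using G e that by (auto simp: graph_def)
    then have "f ` boundary G {v} = boundary H {\<phi> v}"
      using f by (auto simp: local_bijection_def bij_betw_def)
    with e that show ?thesis by (auto simp: boundary_singleton)
  qed
  show "\<phi> ` ends G e \<subseteq> ends H (f e)" using * by blast
  show "f e \<in> edges H" using * graph_edge_ends[OF G e] by (metis insertI1)
qed

text \<open>An edge of \<open>G\<close> is sent to an edge containing the images of both its ends, so walks in \<open>G\<close>
  are sent to walks in \<open>H\<close>.\<close>

lemma local_bijection_reachable:
  assumes G: "graph G" and H: "graph H" and f: "local_bijection G H f \<phi>"
    and "(v, w) \<in> (adjacency G)\<^sup>*"
  shows "(\<phi> v, \<phi> w) \<in> (adjacency H)\<^sup>*"
  using assms(4)
proof (induction rule: rtrancl_induct)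
  case (step w z)
  obtain e where e: "e \<in> edges G" "ends G e = {w, z}"
    using step(2) by (auto simp: adjacency_def)
  have "f e \<in> edges H" "{\<phi> w, \<phi> z} \<subseteq> ends H (f e)"
    using local_bijection_edge[OF G f e(1)] e(2) by auto
  moreover obtain p q where "ends H (f e) = {p, q}" "p \<noteq> q"
    using graph_edge_ends[OF H \<open>f e \<in> edges H\<close>] .
  ultimately have "\<phi> w = \<phi> z \<or> ends H (f e) = {\<phi> w, \<phi> z}" by auto
  with \<open>f e \<in> edges H\<close> have "\<phi> w = \<phi> z \<or> (\<phi> w, \<phi> z) \<in> adjacency H"
    by (auto simp: adjacency_def)
  with step.IH show ?case by (metis rtrancl.rtrancl_into_rtrancl)
qed simp

lemma sym_adjacency: "sym (adjacency G)"
  by (auto simp: adjacency_def sym_def insert_commute)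

lemma adjacency_rtrancl_sym: "(v, w) \<in> (adjacency G)\<^sup>* \<Longrightarrow> (w, v) \<in> (adjacency G)\<^sup>*"
  using sym_adjacency by (metis sym_rtrancl symD)

text \<open>If the images of the vertices are all of \<open>H\<close> but possibly one vertex, that vertex can only be
  joined to images.\<close>

lemma connected_if_local_bijection:
  assumes G: "graph G" "connected_graph G" and H: "graph H" and f: "local_bijection G H f \<phi>"
    and cover: "verts H - \<phi> ` verts G \<subseteq> {x}"
    and deg: "x \<in> verts H \<Longrightarrow> boundary H {x} \<noteq> {}"
  shows "connected_graph H"
proof -
  obtain v0 where v0: "v0 \<in> verts G" using G(2) by (auto simp: connected_graph_def)
  have img: "(\<phi> v, \<phi> w) \<in> (adjacency H)\<^sup>*" if "v \<in> verts G" "w \<in> verts G" for v w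
    using local_bijection_reachable[OF G(1) H f] that G(2) by (auto simp: connected_graph_def)
  have *: "(\<phi> v0, a) \<in> (adjacency H)\<^sup>*" if a: "a \<in> verts H" for a
  proof (cases "a \<in> \<phi> ` verts G")
    case True
    then show ?thesis using img v0 by blast
  next
    case False
    then have "a = x" using cover a by blast
    then obtain e where e: "e \<in> boundary H {x}" using deg a by blast
    obtain b where b: "ends H e = {x, b}" "x \<noteq> b" "b \<in> verts H"
      using graph_edge_at[OF H e] by metis
    then have "b \<in> \<phi> ` verts G" using cover by blast
    then have "(\<phi> v0, b) \<in> (adjacency H)\<^sup>*" using img v0 by blast
    moreover have "(b, x) \<in> adjacency H"
      using e b(1) by (auto simp: adjacency_def boundary_singleton insert_commute)
    ultimately show ?thesis using \<open>a = x\<close> by simp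
  qed
  have "\<phi> v0 \<in> verts H" using f v0 by (auto simp: local_bijection_def)
  moreover have "(a, b) \<in> (adjacency H)\<^sup>*" if "a \<in> verts H" "b \<in> verts H" for a b
    using *[OF that(1)] *[OF that(2)] by (meson adjacency_rtrancl_sym rtrancl_trans)
  ultimately show ?thesis by (auto simp: connected_graph_def)
qed


section \<open>Splitting off at a vertex of the wrong degree\<close>

text \<open>An \<open>r\<close>-graph in which one side of a cut has been contracted to the vertex \<open>x\<close>: only the
  odd sets that avoid \<open>x\<close> have to leave at least \<open>r\<close> edges, and \<open>x\<close> may have any degree.\<close>

definition rooted_r_graph :: "nat \<Rightarrow> ('v, 'e) mgraph \<Rightarrow> 'v \<Rightarrow> bool" where
  "rooted_r_graph r K x \<longleftrightarrow> graph K \<and> x \<in> verts K \<and>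
     (\<forall>u\<in>verts K - {x}. card (boundary K {u}) = r) \<and>
     (\<forall>Y. Y \<subseteq> verts K - {x} \<and> odd (card Y) \<longrightarrow> r \<le> card (boundary K Y))"

definition tight_set :: "nat \<Rightarrow> ('v, 'e) mgraph \<Rightarrow> 'v \<Rightarrow> 'v set \<Rightarrow> bool" where
  "tight_set r K x Y \<longleftrightarrow> Y \<subseteq> verts K - {x} \<and> odd (card Y) \<and> card (boundary K Y) = r"

text \<open>If \<open>|Y \<inter> Z|\<close> were even, then \<open>Y - Z\<close> and \<open>Z - Y\<close> would be odd and the edge from
  \<open>u\<close> to \<open>x\<close> would push one of their cuts below \<open>r\<close>.\<close>

lemma tight_set_Un:
  assumes K: "rooted_r_graph r K x" and Y: "tight_set r K x Y" and Z: "tight_set r K x Z"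
    and u: "u \<in> Y \<inter> Z" and d: "d \<in> edges K" "ends K d = {u, x}"
  shows "tight_set r K x (Y \<union> Z)"
proof -
  have G: "graph K" and
    cut: "\<And>S. S \<subseteq> verts K - {x} \<Longrightarrow> odd (card S) \<Longrightarrow> r \<le> card (boundary K S)"
    using K by (auto simp: rooted_r_graph_def)
  have sub: "Y \<subseteq> verts K - {x}" "Z \<subseteq> verts K - {x}"
    and odd: "odd (card Y)" "odd (card Z)"
    and r: "card (boundary K Y) = r" "card (boundary K Z) = r"
    using Y Z by (auto simp: tight_set_def)
  have fin: "finite Y" "finite Z"
    using G sub finite_subset[of _ "verts K - {x}"] by (auto simp: graph_def)
  have YZ: "card Y = card (Y \<inter> Z) + card (Y - Z)" "card Z = card (Y \<inter> Z) + card (Z - Y)"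
    using card_Int_Diff[OF fin(1), of Z] card_Int_Diff[OF fin(2), of Y] by (simp_all add: Int_commute)
  have "odd (card (Y \<inter> Z))"
  proof (rule ccontr)
    assume "\<not> odd (card (Y \<inter> Z))"
    with YZ odd have "odd (card (Y - Z))" "odd (card (Z - Y))" by simp_all
    then have "r + r \<le> card (boundary K (Y - Z)) + card (boundary K (Z - Y))"
      using sub by (intro add_mono cut) auto
    also have "\<dots> < r + r"
      using card_boundary_posimodular_strict[OF G d u] sub r by auto
    finally show False by simp
  qed
  moreover from this have "odd (card (Y \<union> Z))"
    using odd card_Un_Int[OF fin] by presburger
  moreover have "r \<le> card (boundary K (Y \<inter> Z))" "r \<le> card (boundary K (Y \<union> Z))"
    using sub calculation by (auto intro!: cut)
  ultimately show ?thesis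
    using card_boundary_submodular[OF G, of Y Z] r sub by (auto simp: tight_set_def)
qed

text \<open>A largest tight set \<open>Y\<close> containing a neighbour \<open>u\<close> of \<open>x\<close> absorbs every tight set through
  \<open>u\<close>. It cannot contain all neighbours of \<open>x\<close>, as then the cut of the remaining vertices would
  have only \<open>r - deg x\<close> edges.\<close>

lemma ex_admissible_pair:
  assumes K: "rooted_r_graph r K x"
    and deg: "boundary K {x} \<noteq> {}" "odd (card (verts K - {x})) \<Longrightarrow> r < card (boundary K {x})"
  obtains d1 d2 u v where
    "d1 \<in> edges K" "ends K d1 = {u, x}" "d2 \<in> edges K" "ends K d2 = {v, x}"
    "u \<in> verts K - {x}" "v \<in> verts K - {x}"
    "\<And>Y. tight_set r K x Y \<Longrightarrow> \<not> (u \<in> Y \<and> v \<in> Y)"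
proof -
  have G: "graph K" and degr: "\<And>u. u \<in> verts K - {x} \<Longrightarrow> card (boundary K {u}) = r" and
    cut: "\<And>S. S \<subseteq> verts K - {x} \<Longrightarrow> odd (card S) \<Longrightarrow> r \<le> card (boundary K S)"
    using K by (auto simp: rooted_r_graph_def)
  define U where "U = verts K - {x}"
  have finU: "finite U" using G by (simp add: graph_def U_def)
  from deg(1) obtain d1 where d1: "d1 \<in> boundary K {x}" by blast
  obtain u where u: "ends K d1 = {x, u}" "x \<noteq> u" "u \<in> verts K"
    using graph_edge_at[OF G d1] by metis
  define \<T> where "\<T> = {Y. tight_set r K x Y \<and> u \<in> Y}"
  have "\<T> \<subseteq> Pow U" by (auto simp: \<T>_def tight_set_def U_def)
  then have "finite \<T>" using finU finite_subset by blast
  moreover have "{u} \<in> \<T>" using u degr by (simp add: \<T>_def tight_set_def)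
  ultimately obtain Y where "Y \<in> \<T>" and max: "\<And>Z. Z \<in> \<T> \<Longrightarrow> Y \<subseteq> Z \<Longrightarrow> Y = Z"
    using finite_has_maximal2 by metis
  then have Y: "tight_set r K x Y" "u \<in> Y" by (simp_all add: \<T>_def)
  then have YU: "Y \<subseteq> U" "odd (card Y)" "card (boundary K Y) = r"
    by (auto simp: tight_set_def U_def)
  have absorb: "Z \<subseteq> Y" if "tight_set r K x Z" "u \<in> Z" for Z
  proof -
    have "tight_set r K x (Y \<union> Z)"
    proof (rule tight_set_Un[OF K Y(1) that(1)])
      show "u \<in> Y \<inter> Z" using Y that by simp
      show "d1 \<in> edges K" "ends K d1 = {u, x}"
        using d1 u by (auto simp: boundary_singleton)
    qed
    then have "Y = Y \<union> Z" using max Y by (auto simp: \<T>_def)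
    then show ?thesis by blast
  qed
  \<comment> \<open>If all neighbours of \<open>x\<close> lie in \<open>Y\<close>, the \<open>r\<close> cut edges of \<open>Y\<close> comprise the star of
    \<open>x\<close> and the cut of \<open>U - Y\<close>.\<close>
  have "\<exists>d2 v. d2 \<in> boundary K {x} \<and> ends K d2 = {x, v} \<and> v \<in> U - Y"
  proof (rule ccontr)
    assume none: "\<not> ?thesis"
    have inY: "\<exists>v\<in>Y. ends K d = {x, v} \<and> x \<noteq> v" if "d \<in> boundary K {x}" for d
    proof -
      obtain v where "ends K d = {x, v}" "x \<noteq> v" "v \<in> verts K"
        using graph_edge_at[OF G \<open>d \<in> boundary K {x}\<close>] by metis
      with none that show ?thesis by (auto simp: U_def)
    qed
    have "x \<notin> Y" using YU by (auto simp: U_def)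
    have "boundary K {x} \<subseteq> boundary K Y"
    proof
      fix d assume d: "d \<in> boundary K {x}"
      with inY obtain v where v: "v \<in> Y" "ends K d = {x, v}" "x \<noteq> v" by blast
      with d \<open>x \<notin> Y\<close> show "d \<in> boundary K Y"
        using mem_boundary_pair[of d K x v Y] boundary_subset_edges[of K "{x}"] by blast
    qed
    have "boundary K (U - Y) \<union> boundary K {x} \<subseteq> boundary K Y"
    proof
      fix d assume d: "d \<in> boundary K (U - Y) \<union> boundary K {x}"
      show "d \<in> boundary K Y"
      proof (cases "d \<in> boundary K {x}")
        case False
        then have dE: "d \<in> edges K" "x \<notin> ends K d" "card (ends K d \<inter> (U - Y)) = 1"
          using d by (auto simp: boundary_singleton boundary_def)
        obtain p q where pq: "ends K d = {p, q}" "p \<noteq> q" "p \<in> verts K" "q \<in> verts K"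
          using graph_edge_ends[OF G dE(1)] .
        have "(p \<in> U - Y) \<noteq> (q \<in> U - Y)" using dE(3) unfolding pq(1) pair_cut_iff[OF pq(2)] .
        moreover have "p \<in> U" "q \<in> U" using pq dE(2) by (auto simp: U_def)
        ultimately have "(p \<in> Y) \<noteq> (q \<in> Y)" by blast
        then show ?thesis using mem_boundary_pair[OF dE(1) pq(1,2)] by blast
      qed (use \<open>boundary K {x} \<subseteq> boundary K Y\<close> in blast)
    qed
    moreover have "boundary K (U - Y) \<inter> boundary K {x} = {}"
    proof (rule ccontr)
      assume "boundary K (U - Y) \<inter> boundary K {x} \<noteq> {}"
      then obtain d where d: "d \<in> boundary K (U - Y)" "d \<in> boundary K {x}" by blast
      with inY obtain v where "v \<in> Y" "ends K d = {x, v}" "x \<noteq> v" by blast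
      with d(1) show False
        using mem_boundary_pair[of d K x v "U - Y"] boundary_subset_edges[of K "U - Y"]
        by (auto simp: U_def)
    qed
    ultimately have sum: "card (boundary K (U - Y)) + card (boundary K {x}) \<le> r"
      using YU(3) finite_boundary[OF G]
      by (metis card_Un_disjoint card_mono)
    have "card (boundary K {x}) > 0" using deg(1) finite_boundary[OF G] by (simp add: card_gt_0_iff)
    show False
    proof (cases "odd (card U)")
      case True
      with deg(2) sum show False by (simp add: U_def)
    next
      case False
      then have "odd (card (U - Y))"
        using YU(1,2) finU card_mono[OF finU YU(1)] by (simp add: card_Diff_subset finite_subset)
      then have "r \<le> card (boundary K (U - Y))" by (intro cut) (auto simp: U_def)
      with sum \<open>card (boundary K {x}) > 0\<close> show False by simp
    qed
  qed
  then obtain d2 v where d2: "d2 \<in> boundary K {x}" "ends K d2 = {x, v}" "v \<in> U - Y" by blast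
  show thesis
  proof (rule that)
    show "d1 \<in> edges K" "ends K d1 = {u, x}" "d2 \<in> edges K" "ends K d2 = {v, x}"
      using d1 d2 u by (auto simp: boundary_singleton)
    show "u \<in> verts K - {x}" "v \<in> verts K - {x}" using u d2 by (auto simp: U_def)
    show "\<not> (u \<in> Z \<and> v \<in> Z)" if "tight_set r K x Z" for Z using absorb[OF that] d2 by blast
  qed
qed

definition split_off :: "('v, 'e) mgraph \<Rightarrow> 'e \<Rightarrow> 'e \<Rightarrow> 'v \<Rightarrow> 'v \<Rightarrow> ('v, 'e) mgraph" where
  "split_off K d1 d2 u v =
     K\<lparr>edges := edges K - {d2}, ends := (ends K)(d1 := {u, v})\<rparr>"

text \<open>Seen from the vertices other than \<open>x\<close>, splitting off only renames \<open>d2\<close> to \<open>d1\<close>.\<close>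

lemma boundary_split_off:
  assumes d: "d1 \<in> edges K" "ends K d1 = {u, x}" "d2 \<in> edges K" "ends K d2 = {v, x}"
    and ne: "u \<noteq> v" "u \<noteq> x" "v \<noteq> x" and x: "x \<notin> Y"
  shows "u \<in> Y \<and> v \<in> Y \<Longrightarrow> boundary (split_off K d1 d2 u v) Y = boundary K Y - {d1, d2}"
    and "\<not> (u \<in> Y \<and> v \<in> Y) \<Longrightarrow> bij_betw (id(d2 := d1)) (boundary K Y) (boundary (split_off K d1 d2 u v) Y)"
proof -
  let ?K = "split_off K d1 d2 u v"
  have "d1 \<noteq> d2" using d ne by (auto simp: doubleton_eq_iff)
  have mem: "d1 \<in> boundary K Y \<longleftrightarrow> u \<in> Y" "d2 \<in> boundary K Y \<longleftrightarrow> v \<in> Y"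
    "d1 \<in> boundary ?K Y \<longleftrightarrow> (u \<in> Y) \<noteq> (v \<in> Y)" "d2 \<notin> boundary ?K Y"
    using mem_boundary_pair[OF d(1,2) ne(2), of Y] mem_boundary_pair[OF d(3,4) ne(3), of Y]
      mem_boundary_pair[of d1 ?K u v Y] d(1) ne(1) x \<open>d1 \<noteq> d2\<close>
    by (simp_all add: split_off_def) (simp add: boundary_def)
  have other: "e \<in> boundary ?K Y \<longleftrightarrow> e \<in> boundary K Y" if "e \<noteq> d1" "e \<noteq> d2" for e
    using that by (simp add: boundary_def split_off_def)
  show "boundary ?K Y = boundary K Y - {d1, d2}" if "u \<in> Y \<and> v \<in> Y"
  proof (rule set_eqI)
    fix e show "e \<in> boundary ?K Y \<longleftrightarrow> e \<in> boundary K Y - {d1, d2}"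
      using mem other[of e] that by (cases "e = d1 \<or> e = d2") auto
  qed
  show "bij_betw (id(d2 := d1)) (boundary K Y) (boundary ?K Y)" if uv: "\<not> (u \<in> Y \<and> v \<in> Y)"
  proof (rule bij_betwI')
    fix e e' assume "e \<in> boundary K Y" "e' \<in> boundary K Y"
    then show "((id(d2 := d1)) e = (id(d2 := d1)) e') = (e = e')"
      using mem uv by auto
  next
    fix e assume "e \<in> boundary K Y"
    then show "(id(d2 := d1)) e \<in> boundary ?K Y"
      using mem uv other[of e] by (cases "e = d1"; cases "e = d2") auto
  next
    fix e assume e: "e \<in> boundary ?K Y"
    show "\<exists>e'\<in>boundary K Y. e = (id(d2 := d1)) e'"
    proof (cases "e = d1 \<and> v \<in> Y")
      case True
      then show ?thesis using mem by (intro bexI[of _ d2]) auto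
    next
      case False
      then show ?thesis using e mem uv other[of e]
        by (intro bexI[of _ e]) (cases "e = d1"; cases "e = d2"; auto)+
    qed
  qed
qed

lemma rooted_r_graph_split_off:
  assumes K: "rooted_r_graph r K x"
    and d: "d1 \<in> edges K" "ends K d1 = {u, x}" "d2 \<in> edges K" "ends K d2 = {v, x}"
    and uv: "u \<in> verts K - {x}" "v \<in> verts K - {x}" "u \<noteq> v"
    and tight: "\<And>Y. tight_set r K x Y \<Longrightarrow> \<not> (u \<in> Y \<and> v \<in> Y)"
  shows "rooted_r_graph r (split_off K d1 d2 u v) x"
    and "a \<in> verts K - {x} \<Longrightarrow>
      bij_betw (id(d2 := d1)) (boundary K {a}) (boundary (split_off K d1 d2 u v) {a})"
proof -
  let ?K = "split_off K d1 d2 u v"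
  have G: "graph K" and degr: "\<And>u. u \<in> verts K - {x} \<Longrightarrow> card (boundary K {u}) = r" and
    cut: "\<And>S. S \<subseteq> verts K - {x} \<Longrightarrow> odd (card S) \<Longrightarrow> r \<le> card (boundary K S)"
    using K by (auto simp: rooted_r_graph_def)
  have ux: "u \<noteq> x" "v \<noteq> x" using uv by auto
  note bd = boundary_split_off[OF d uv(3) ux]
  show bij: "bij_betw (id(d2 := d1)) (boundary K {a}) (boundary ?K {a})" if "a \<in> verts K - {x}" for a
    using that uv(3) by (intro bd(2)) auto
  have "graph ?K"
    using G uv by (auto simp: graph_def split_off_def)
  moreover have "r \<le> card (boundary ?K Y)" if Y: "Y \<subseteq> verts K - {x}" "odd (card Y)" for Y
  proof (cases "u \<in> Y \<and> v \<in> Y")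
    case True
    \<comment> \<open>By parity, an odd cut that is not tight has at least \<open>r + 2\<close> edges.\<close>
    have "even (card (boundary K Y)) \<longleftrightarrow> even (r * card Y)"
      using Y degr by (intro even_card_boundary[OF G]) auto
    then have "even (card (boundary K Y)) \<longleftrightarrow> even r" using Y(2) by simp
    moreover have "card (boundary K Y) \<noteq> r"
      using tight[of Y] True Y by (auto simp: tight_set_def)
    moreover have "r \<le> card (boundary K Y)" using cut Y by blast
    ultimately have "r + 2 \<le> card (boundary K Y)" by presburger
    also have "card (boundary K Y) \<le> card (boundary K Y - {d1, d2}) + card {d1, d2}"
      using diff_card_le_card_Diff[of "{d1, d2}" "boundary K Y"] by simp
    also have "card {d1, d2} \<le> 2" by (simp add: card_insert_if)
    finally have "r \<le> card (boundary K Y - {d1, d2})" by simp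
    moreover have "x \<notin> Y" using Y(1) by blast
    ultimately show ?thesis using bd(1)[of Y] True by simp
  next
    case False
    moreover have "x \<notin> Y" using Y(1) by blast
    ultimately show ?thesis using bij_betw_same_card[OF bd(2)[of Y]] cut[OF Y] by simp
  qed
  moreover have "card (boundary ?K {a}) = r" if "a \<in> verts K - {x}" for a
    using bij_betw_same_card[OF bij[OF that]] degr[OF that] by simp
  ultimately show "rooted_r_graph r ?K x"
    using K by (simp add: rooted_r_graph_def) (simp add: split_off_def)
qed

text \<open>Splitting off can go on until \<open>x\<close> is isolated, and is then deleted, or there is an odd number
  of other vertices and \<open>x\<close> has degree \<open>r\<close>. All stars at the other vertices survive.\<close>

lemma rooted_r_graph_completion:
  fixes K :: "('v, 'e) mgraph"
  assumes "rooted_r_graph r K x"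
  shows "\<exists>(K' :: ('v, 'e) mgraph) (g :: 'e \<Rightarrow> 'e). r_graph r K' \<and> verts K - {x} \<subseteq> verts K' \<and> verts K' \<subseteq> verts K \<and>
    (\<forall>a\<in>verts K - {x}. bij_betw g (boundary K {a}) (boundary K' {a}))"
  using assms
proof (induction "card (edges K)" arbitrary: K rule: less_induct)
  case (less K)
  define U where "U = verts K - {x}"
  have G: "graph K" and x: "x \<in> verts K" and
    degr: "\<And>u. u \<in> U \<Longrightarrow> card (boundary K {u}) = r" and
    cut: "\<And>S. S \<subseteq> U \<Longrightarrow> odd (card S) \<Longrightarrow> r \<le> card (boundary K S)"
    using less.prems by (auto simp: rooted_r_graph_def U_def)
  have finU: "finite U" using G by (simp add: graph_def U_def)
  have V: "verts K = insert x U" "x \<notin> U" using x by (auto simp: U_def)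
  have "boundary K {x} = boundary K U"
    using boundary_complement[OF G, of "{x}"] x by (simp add: U_def)
  consider (isolated) "even (card U)" "boundary K {x} = {}"
    | (regular) "odd (card U)" "card (boundary K {x}) = r"
    | (split) "boundary K {x} \<noteq> {}" "odd (card U) \<Longrightarrow> r < card (boundary K {x})"
  proof (cases "odd (card U)")
    case True
    with cut[of U] \<open>boundary K {x} = boundary K U\<close> have "r \<le> card (boundary K {x})" by simp
    then consider "card (boundary K {x}) = r" | "r < card (boundary K {x})" "boundary K {x} \<noteq> {}"
      by fastforce
    then show thesis using that True by cases blast+
  next
    case False
    then show thesis using that by blast
  qed
  then show ?case
  proof cases
    case isolated
    let ?K = "K\<lparr>verts := U\<rparr>"
    have bd: "boundary ?K S = boundary K S" for S by (simp add: boundary_def)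
    have "x \<notin> ends K e" if "e \<in> edges K" for e
      using isolated(2) that by (auto simp: boundary_singleton)
    then have "graph ?K" using G finU V by (auto simp: graph_def)
    then have "r_graph r ?K"
      using degr cut by (simp add: r_graph_def regular_graph_def bd)
    moreover have "\<forall>a\<in>verts K - {x}. bij_betw id (boundary K {a}) (boundary ?K {a})"
      by (simp only: bd bij_betw_id) simp
    ultimately show ?thesis
      by (intro exI[of _ ?K] exI[of _ id]) (simp add: U_def Diff_subset)
  next
    case regular
    have "r \<le> card (boundary K S)" if S: "S \<subseteq> verts K" "odd (card S)" for S
    proof (cases "x \<in> S")
      case True
      have "finite (verts K)" using G by (simp add: graph_def)
      have "card (verts K - S) = card (verts K) - card S"
        using S \<open>finite (verts K)\<close> by (simp add: card_Diff_subset finite_subset)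
      moreover have "card S \<le> card (verts K)" using S \<open>finite (verts K)\<close> by (simp add: card_mono)
      moreover have "even (card (verts K))" using V finU regular(1) by simp
      ultimately have "odd (card (verts K - S))" using S(2) by simp
      then have "r \<le> card (boundary K (verts K - S))"
        using True by (intro cut) (auto simp: U_def)
      then show ?thesis using boundary_complement[OF G S(1)] by simp
    next
      case False
      then show ?thesis using S by (intro cut) (auto simp: U_def)
    qed
    then have "r_graph r K"
      using G degr regular(2) V by (auto simp: r_graph_def regular_graph_def)
    then show ?thesis
      by (intro exI[of _ K] exI[of _ id]) auto
  next
    case split
    obtain d1 d2 u v where
      d: "d1 \<in> edges K" "ends K d1 = {u, x}" "d2 \<in> edges K" "ends K d2 = {v, x}"
      and uv: "u \<in> verts K - {x}" "v \<in> verts K - {x}"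
      and tight: "\<And>Y. tight_set r K x Y \<Longrightarrow> \<not> (u \<in> Y \<and> v \<in> Y)"
      using ex_admissible_pair[OF less.prems split(1)] split(2) unfolding U_def by metis
    \<comment> \<open>Singletons are tight, so parallel edges are never paired and no loop arises.\<close>
    have "tight_set r K x {u}" using uv degr by (simp add: tight_set_def U_def)
    then have "u \<noteq> v" using tight by blast
    let ?K = "split_off K d1 d2 u v"
    note so = rooted_r_graph_split_off[OF less.prems d uv \<open>u \<noteq> v\<close> tight]
    have "card (edges ?K) < card (edges K)"
      using d(3) G card_Diff1_less[of "edges K" d2] by (simp add: split_off_def graph_def)
    moreover have "verts ?K = verts K" by (simp add: split_off_def)
    ultimately obtain K' :: "('v, 'e) mgraph" and g :: "'e \<Rightarrow> 'e" where
      K': "r_graph r K'" "verts K - {x} \<subseteq> verts K'" "verts K' \<subseteq> verts K"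
      "\<forall>a\<in>verts K - {x}. bij_betw g (boundary ?K {a}) (boundary K' {a})"
      using less.hyps[OF _ so(1)] by metis
    then have "\<forall>a\<in>verts K - {x}. bij_betw (g \<circ> id(d2 := d1)) (boundary K {a}) (boundary K' {a})"
      using so(2) bij_betw_trans by blast
    with K' show ?thesis by blast
  qed
qed

section \<open>Graphs not colored by smaller graphs\<close>

lemma r_graphD: "r_graph r G \<Longrightarrow> graph G" "r_graph r G \<Longrightarrow> v \<in> verts G \<Longrightarrow> card (boundary G {v}) = r"
  by (auto simp: r_graph_def regular_graph_def)

lemma r_graph_odd_cut: "r_graph r G \<Longrightarrow> X \<subseteq> verts G \<Longrightarrow> odd (card X) \<Longrightarrow> r \<le> card (boundary G X)"
  by (auto simp: r_graph_def)

definition contraction :: "('v, 'e) mgraph \<Rightarrow> 'v set \<Rightarrow> 'v \<Rightarrow> ('v, 'e) mgraph" where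
  "contraction H U x = \<lparr>verts = insert x U, edges = {e \<in> edges H. ends H e \<inter> U \<noteq> {}},
     ends = (\<lambda>e. if ends H e \<subseteq> U then ends H e else insert x (ends H e \<inter> U))\<rparr>"

lemma boundary_contraction:
  assumes H: "graph H" and x: "x \<notin> U" and Y: "Y \<subseteq> U"
  shows "boundary (contraction H U x) Y = boundary H Y"
proof -
  have "ends (contraction H U x) e \<inter> Y = ends H e \<inter> Y" for e
    using x Y by (auto simp: contraction_def)
  moreover have "e \<in> edges (contraction H U x) \<longleftrightarrow> e \<in> edges H" if "card (ends H e \<inter> Y) = 1" for e
    using that Y by (fastforce simp: contraction_def card_1_singleton_iff)
  ultimately show ?thesis by (auto simp: boundary_def)
qed

lemma rooted_r_graph_contraction:
  assumes H: "r_graph r H" and U: "U \<subseteq> verts H" and x: "x \<notin> U"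
  shows "rooted_r_graph r (contraction H U x) x"
proof -
  let ?K = "contraction H U x"
  note G = r_graphD(1)[OF H]
  have V: "verts ?K - {x} = U" using x by (auto simp: contraction_def)
  have "ends ?K e \<subseteq> verts ?K \<and> card (ends ?K e) = 2" if "e \<in> edges ?K" for e
  proof -
    have e: "e \<in> edges H" "ends H e \<inter> U \<noteq> {}" using that by (auto simp: contraction_def)
    obtain p q where pq: "ends H e = {p, q}" "p \<noteq> q" using graph_edge_ends[OF G e(1)] .
    show ?thesis
      using e(2) pq(2) x by (cases "p \<in> U"; cases "q \<in> U") (auto simp: contraction_def pq(1) card_insert_if)
  qed
  moreover have "finite (verts ?K)" "finite (edges ?K)"
    using G finite_subset[OF U] by (simp_all add: contraction_def graph_def)
  ultimately have "graph ?K" by (simp add: graph_def)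
  moreover have "card (boundary ?K {u}) = r" if "u \<in> U" for u
    using boundary_contraction[OF G x, of "{u}"] that U r_graphD(2)[OF H, of u] by auto
  moreover have "r \<le> card (boundary ?K Y)" if "Y \<subseteq> U" "odd (card Y)" for Y
    using boundary_contraction[OF G x that(1)] that U r_graph_odd_cut[OF H, of Y] by auto
  moreover have "x \<in> verts ?K" by (simp add: contraction_def)
  ultimately show ?thesis by (simp add: rooted_r_graph_def V)
qed

text \<open>The edges over an edge \<open>ab\<close> of \<open>H\<close> form a perfect matching of the vertices over \<open>a\<close> and
  \<open>b\<close>.\<close>

lemma even_fibres_over_edge:
  assumes G: "graph G" and H: "graph H" and f: "local_bijection G H f \<phi>" and d: "d \<in> edges H"
  shows "even (card {v \<in> verts G. \<phi> v \<in> ends H d})"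
proof -
  define F where "F = {e \<in> edges G. f e = d}"
  define S where "S = {v \<in> verts G. \<phi> v \<in> ends H d}"
  have "finite F" "finite S" using G by (simp_all add: F_def S_def graph_def)
  have one: "card {e \<in> F. v \<in> ends G e} = 1" if "v \<in> S" for v
  proof -
    have v: "v \<in> verts G" "d \<in> boundary H {\<phi> v}"
      using \<open>v \<in> S\<close> d by (auto simp: S_def boundary_singleton)
    have bij: "inj_on f (boundary G {v})" "f ` boundary G {v} = boundary H {\<phi> v}"
      using f v(1) by (auto simp: local_bijection_def bij_betw_def)
    then obtain e where e: "e \<in> boundary G {v}" "f e = d" using v(2) by (metis imageE)
    then have "{e \<in> F. v \<in> ends G e} = {e}"
      using bij(1) by (auto simp: F_def boundary_singleton inj_on_def)
    then show ?thesis by simp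
  qed
  have two: "card (ends G e \<inter> S) = 2" if "e \<in> F" for e
  proof -
    have e: "e \<in> edges G" "f e = d" using that by (auto simp: F_def)
    then have "ends G e \<subseteq> S" "card (ends G e) = 2"
      using local_bijection_edge(2)[OF G f e(1)] G by (auto simp: S_def graph_def)
    then show ?thesis by (simp add: Int_absorb2)
  qed
  have "card S = (\<Sum>v\<in>S. card {e \<in> F. v \<in> ends G e})" using one by simp
  also have "\<dots> = (\<Sum>v\<in>S. \<Sum>e\<in>F. of_bool (v \<in> ends G e))"
    using \<open>finite F\<close> by (simp add: Int_def)
  also have "\<dots> = (\<Sum>e\<in>F. \<Sum>v\<in>S. of_bool (v \<in> ends G e))" by (rule sum.swap)
  also have "\<dots> = (\<Sum>e\<in>F. card (ends G e \<inter> S))"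
    using \<open>finite S\<close> by (simp add: Int_def conj_commute)
  also have "\<dots> = 2 * card F" using two by simp
  finally show ?thesis by (simp add: S_def)
qed

text \<open>Some vertex outside the image is joined to an image vertex \<open>a\<close>, whose fibre is then matched
  within itself. Parity spreads from a fibre to the neighbouring ones, so all fibres are even.\<close>

lemma card_image_le_half:
  assumes G: "graph G" "connected_graph G" and H: "graph H" "connected_graph H"
    and f: "local_bijection G H f \<phi>" and proper: "\<phi> ` verts G \<noteq> verts H"
  shows "2 * card (\<phi> ` verts G) \<le> card (verts G)"
proof -
  define fib where "fib a = {v \<in> verts G. \<phi> v = a}" for a
  define U where "U = \<phi> ` verts G"
  have fin: "finite (verts G)" "finite U" "\<And>a. finite (fib a)"
    using G by (simp_all add: graph_def U_def fib_def)
  have UH: "U \<subset> verts H" using f proper by (auto simp: U_def local_bijection_def)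
  have fib_edge: "even (card (fib a) + card (fib b))" if "d \<in> edges H" "ends H d = {a, b}" "a \<noteq> b" for a b d
  proof -
    have "{v \<in> verts G. \<phi> v \<in> ends H d} = fib a \<union> fib b" using that by (auto simp: fib_def)
    moreover have "fib a \<inter> fib b = {}" using that by (auto simp: fib_def)
    ultimately show ?thesis
      using even_fibres_over_edge[OF G(1) H(1) f that(1)] fin by (simp add: card_Un_disjoint)
  qed
  have U_step: "\<exists>a\<in>U. \<exists>b\<in>verts H - U. (a, b) \<in> adjacency H"
  proof (rule ccontr)
    assume none: "\<not> ?thesis"
    obtain v0 b where v0: "v0 \<in> verts G" and b: "b \<in> verts H" "b \<notin> U"
      using G(2) UH by (auto simp: connected_graph_def)
    have "\<phi> v0 \<in> U" using v0 by (simp add: U_def)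
    have "(\<phi> v0, b) \<in> (adjacency H)\<^sup>*"
      using H(2) b UH \<open>\<phi> v0 \<in> U\<close> by (auto simp: connected_graph_def)
    then have "b \<in> U"
    proof (induction rule: rtrancl_induct)
      case (step y z)
      then have "z \<in> verts H" using H(1) by (auto simp: adjacency_def graph_def)
      with step none show ?case by blast
    qed (rule \<open>\<phi> v0 \<in> U\<close>)
    with b show False by simp
  qed
  then obtain a b d where ab: "a \<in> U" "b \<notin> U" "d \<in> edges H" "ends H d = {a, b}"
    by (auto simp: adjacency_def)
  have "fib b = {}" using ab(2) by (auto simp: fib_def U_def)
  then have even_a: "even (card (fib a))" using fib_edge[OF ab(3,4)] ab by auto
  have spread: "even (card (fib (\<phi> w)))"
    if "(v, w) \<in> (adjacency G)\<^sup>*" "even (card (fib (\<phi> v)))" for v w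
    using that
  proof (induction rule: rtrancl_induct)
    case (step w z)
    obtain e where e: "e \<in> edges G" "ends G e = {w, z}"
      using step(2) by (auto simp: adjacency_def)
    have fe: "f e \<in> edges H" "{\<phi> w, \<phi> z} \<subseteq> ends H (f e)"
      using local_bijection_edge[OF G(1) f e(1)] e(2) by auto
    obtain p q where "ends H (f e) = {p, q}" "p \<noteq> q"
      using graph_edge_ends[OF H(1) fe(1)] .
    with fe(2) have "\<phi> w = \<phi> z \<or> ends H (f e) = {\<phi> w, \<phi> z} \<and> \<phi> w \<noteq> \<phi> z" by auto
    with fib_edge[OF fe(1)] step show ?case by force
  qed simp
  obtain v where v: "v \<in> verts G" "a = \<phi> v" using ab(1) by (auto simp: U_def)
  have "2 \<le> card (fib c)" if "c \<in> U" for c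
  proof -
    obtain w where w: "w \<in> verts G" "c = \<phi> w" using \<open>c \<in> U\<close> by (auto simp: U_def)
    then have "even (card (fib c))"
      using spread[of v w] G(2) v even_a by (auto simp: connected_graph_def)
    moreover have "card (fib c) \<noteq> 0" using fin w by (auto simp: fib_def)
    ultimately show ?thesis by presburger
  qed
  then have "card U * 2 \<le> (\<Sum>c\<in>U. card (fib c))"
    using sum_bounded_below[of U 2 "\<lambda>c. card (fib c)"] by simp
  also have "\<dots> = card (\<Union>c\<in>U. fib c)"
    using fin by (intro card_UN_disjoint[symmetric]) (auto simp: fib_def)
  also have "(\<Union>c\<in>U. fib c) = verts G" by (auto simp: fib_def U_def)
  finally show ?thesis by (simp add: U_def)
qed

text \<open>The part of \<open>H\<close> outside the image of \<open>G\<close> is replaced by at most one vertex.\<close>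

lemma ex_small_coloring_graph:
  assumes r: "0 < r" and G: "graph G" "connected_graph G"
    and H: "r_graph r (H :: ('v, 'e) mgraph)" "connected_graph H"
    and f: "local_bijection G H f \<phi>" and proper: "\<phi> ` verts G \<noteq> verts H"
  shows "\<exists>H' :: ('v, 'e) mgraph. r_graph r H' \<and> connected_graph H' \<and> colors H' G \<and>
    2 * card (verts H') \<le> card (verts G) + 2"
proof -
  define U where "U = \<phi> ` verts G"
  have UH: "U \<subset> verts H" using f proper by (auto simp: U_def local_bijection_def)
  then obtain x where x: "x \<in> verts H" "x \<notin> U" by blast
  let ?K = "contraction H U x"
  note Hg = r_graphD(1)[OF H(1)]
  have VK: "verts ?K = insert x U" "verts ?K - {x} = U" using x by (auto simp: contraction_def)
  obtain H' :: "('v, 'e) mgraph" and g :: "'e \<Rightarrow> 'e"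
    where H': "r_graph r H'" "U \<subseteq> verts H'" "verts H' \<subseteq> insert x U"
    and g: "\<forall>a\<in>U. bij_betw g (boundary ?K {a}) (boundary H' {a})"
    using rooted_r_graph_completion[OF
      rooted_r_graph_contraction[OF H(1) psubset_imp_subset[OF UH] x(2)], unfolded VK(2), unfolded VK(1)]
    by (elim exE conjE) rule
  have K: "local_bijection G ?K f \<phi>"
    unfolding local_bijection_def
  proof (intro ballI conjI)
    fix v assume v: "v \<in> verts G"
    then have "\<phi> v \<in> U" by (simp add: U_def)
    then show "\<phi> v \<in> verts ?K" by (simp add: VK)
    have "boundary ?K {\<phi> v} = boundary H {\<phi> v}"
      using v by (intro boundary_contraction[OF Hg x(2)]) (simp add: U_def)
    then show "bij_betw f (boundary G {v}) (boundary ?K {\<phi> v})"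
      using f v by (simp add: local_bijection_def)
  qed
  have loc: "local_bijection G H' (g \<circ> f) \<phi>"
    unfolding local_bijection_def
  proof (intro ballI conjI)
    fix v assume v: "v \<in> verts G"
    then have "\<phi> v \<in> U" by (simp add: U_def)
    then show "\<phi> v \<in> verts H'" using H'(2) by blast
    have "bij_betw f (boundary G {v}) (boundary ?K {\<phi> v})"
      using K v by (simp add: local_bijection_def)
    then show "bij_betw (g \<circ> f) (boundary G {v}) (boundary H' {\<phi> v})"
      by (rule bij_betw_trans) (use g \<open>\<phi> v \<in> U\<close> in blast)
  qed
  have "connected_graph H'"
  proof (rule connected_if_local_bijection[OF G r_graphD(1)[OF H'(1)] loc])
    show "verts H' - \<phi> ` verts G \<subseteq> {x}" using H'(3) by (auto simp: U_def)
    show "boundary H' {x} \<noteq> {}" if "x \<in> verts H'"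
      using r_graphD(2)[OF H'(1) that] r by auto
  qed
  moreover have "colors H' G" using loc G(1) by (auto simp: colors_iff_local_bijection)
  moreover have "card (verts H') \<le> card U + 1"
  proof -
    have "finite U" using G by (simp add: U_def graph_def)
    then show ?thesis using card_mono[OF _ H'(3)] by (simp add: card_insert_if split: if_splits)
  qed
  moreover have "2 * card U \<le> card (verts G)"
    unfolding U_def by (rule card_image_le_half[OF G Hg H(2) f proper])
  ultimately show ?thesis using H'(1) by (intro exI[of _ H']) auto
qed

text \<open>With \<open>\<phi>\<close> bijective, edges with the same image have the same ends; being adjacent, they
  coincide.\<close>

lemma isomorphic_if_local_bijection_bij:
  assumes G: "graph G" and H: "graph H" and f: "local_bijection G H f \<phi>"
    and \<phi>: "bij_betw \<phi> (verts G) (verts H)"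
  shows "isomorphic G H"
proof -
  have ends: "ends H (f e) = \<phi> ` ends G e" if "e \<in> edges G" for e
  proof -
    have "inj_on \<phi> (ends G e)" "card (ends G e) = 2"
      using that G \<phi> by (auto simp: graph_def bij_betw_def intro: inj_on_subset)
    then have "card (\<phi> ` ends G e) = 2" by (simp add: card_image)
    moreover have "card (ends H (f e)) = 2" "finite (ends H (f e))"
      using local_bijection_edge(1)[OF G f that] H by (auto simp: graph_def intro: card_ge_0_finite)
    ultimately show ?thesis
      using local_bijection_edge(2)[OF G f that] by (metis card_subset_eq)
  qed
  have "inj_on f (edges G)"
  proof (rule inj_onI)
    fix e e' assume e: "e \<in> edges G" "e' \<in> edges G" "f e = f e'"
    then have "\<phi> ` ends G e = \<phi> ` ends G e'" using ends by metis
    then have same: "ends G e = ends G e'"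
      using inj_on_image_eq_iff[of \<phi> "verts G" "ends G e" "ends G e'"] \<phi> G e(1,2)
      by (simp add: bij_betw_def graph_def)
    obtain p q where "ends G e = {p, q}" "p \<in> verts G" using graph_edge_ends[OF G e(1)] by metis
    moreover from this have "inj_on f (boundary G {p})"
      using f by (auto simp: local_bijection_def bij_betw_def)
    ultimately show "e = e'" using e same by (auto simp: inj_on_def boundary_singleton)
  qed
  moreover have "f ` edges G = edges H"
  proof (intro subset_antisym subsetI)
    fix d assume "d \<in> f ` edges G"
    then show "d \<in> edges H" using local_bijection_edge(1)[OF G f] by blast
  next
    fix d assume d: "d \<in> edges H"
    obtain p q where p: "ends H d = {p, q}" "p \<in> verts H" using graph_edge_ends[OF H d] by metis
    then obtain v where "v \<in> verts G" "p = \<phi> v" using \<phi> by (auto simp: bij_betw_def)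
    then have "d \<in> f ` boundary G {v}"
      using f d p(1) by (auto simp: local_bijection_def bij_betw_def boundary_singleton)
    then show "d \<in> f ` edges G" using boundary_subset_edges[of G "{v}"] by blast
  qed
  ultimately have "bij_betw f (edges G) (edges H)" by (simp add: bij_betw_def)
  then show ?thesis unfolding isomorphic_def using \<phi> ends by blast
qed

text \<open>The bound \<open>2 <\<close> excludes \<open>r\<close> parallel edges: nothing smaller colors them, but every
  \<open>r\<close>-graph does.\<close>

definition core_graph :: "nat \<Rightarrow> nat_graph \<Rightarrow> bool" where
  "core_graph r M \<longleftrightarrow> connected_graph M \<and> r_graph r M \<and> 2 < card (verts M) \<and>
     (\<forall>H :: nat_graph. connected_graph H \<and> r_graph r H \<and> colors H M \<longrightarrow> card (verts M) \<le> card (verts H))"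

text \<open>A coloring graph that is not covered by \<open>M\<close> could be replaced by one with at most
  \<open>|V(M)| / 2 + 1 < |V(M)|\<close> vertices. So \<open>\<phi>\<close> is onto, and minimality makes it injective.\<close>

lemma isomorphic_if_colors_core:
  fixes M H :: nat_graph
  assumes r: "0 < r" and M: "core_graph r M"
    and H: "connected_graph H" "r_graph r H" "colors H M"
  shows "isomorphic M H"
proof -
  have Mg: "graph M" "connected_graph M" "2 < card (verts M)"
    and min: "\<And>H :: nat_graph. connected_graph H \<Longrightarrow> r_graph r H \<Longrightarrow> colors H M \<Longrightarrow>
      card (verts M) \<le> card (verts H)"
    using M by (auto simp: core_graph_def dest: r_graphD(1))
  note Hg = r_graphD(1)[OF H(2)]
  obtain f \<phi> where f: "local_bijection M H f \<phi>"
    using H(3) Mg(1) by (auto simp: colors_iff_local_bijection)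
  have surj: "\<phi> ` verts M = verts H"
  proof (rule ccontr)
    assume "\<phi> ` verts M \<noteq> verts H"
    from ex_small_coloring_graph[OF r Mg(1,2) H(2,1) f this] obtain H' :: nat_graph where
      "r_graph r H'" "connected_graph H'" "colors H' M" "2 * card (verts H') \<le> card (verts M) + 2"
      by blast
    with min[of H'] Mg(3) show False by simp
  qed
  have "finite (verts M)" using Mg(1) by (simp add: graph_def)
  moreover have "card (verts M) \<le> card (\<phi> ` verts M)" using min[OF H] surj by simp
  ultimately have "inj_on \<phi> (verts M)" by (metis card_image_le eq_card_imp_inj_on le_antisym)
  with surj show ?thesis
    using isomorphic_if_local_bijection_bij[OF Mg(1) Hg f] by (simp add: bij_betw_def)
qed

section \<open>The Petersen graph with multiplied spokes\<close>

text \<open>Outer cycle on \<open>0, \<dots>, 4\<close>, inner pentagram on \<open>5, \<dots>, 9\<close>, and \<open>n\<close> parallel spokes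
  \<open>10 + 5 * j + i\<close> joining \<open>i\<close> and \<open>5 + i\<close>.\<close>

definition petersen :: "nat \<Rightarrow> nat_graph" where
  "petersen n = \<lparr>verts = {..<10}, edges = {..<10 + 5 * n},
     ends = (\<lambda>e. if e < 5 then {e, (e + 1) mod 5}
       else if e < 10 then {e, 5 + (e + 2) mod 5} else {e mod 5, 5 + e mod 5})\<rparr>"

lemma petersen_simps:
  "verts (petersen n) = {..<10}" "edges (petersen n) = {..<10 + 5 * n}"
  by (simp_all add: petersen_def)

lemma petersen_ends:
  "ends (petersen n) 0 = {0, 1}" "ends (petersen n) 1 = {1, 2}" "ends (petersen n) 2 = {2, 3}"
  "ends (petersen n) 3 = {3, 4}" "ends (petersen n) 4 = {4, 0}"
  "ends (petersen n) 5 = {5, 7}" "ends (petersen n) 6 = {6, 8}" "ends (petersen n) 7 = {7, 9}"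
  "ends (petersen n) 8 = {8, 5}" "ends (petersen n) 9 = {9, 6}"
  "ends (petersen n) (10 + 5 * j) = {0, 5}" "ends (petersen n) (11 + 5 * j) = {1, 6}"
  "ends (petersen n) (12 + 5 * j) = {2, 7}" "ends (petersen n) (13 + 5 * j) = {3, 8}"
  "ends (petersen n) (14 + 5 * j) = {4, 9}"
proof -
  have "(10 + 5 * j) mod 5 = 0" "(11 + 5 * j) mod 5 = 1" "(12 + 5 * j) mod 5 = 2"
    "(13 + 5 * j) mod 5 = 3" "(14 + 5 * j) mod 5 = 4" by presburger+
  then show "ends (petersen n) (10 + 5 * j) = {0, 5}" "ends (petersen n) (11 + 5 * j) = {1, 6}"
    "ends (petersen n) (12 + 5 * j) = {2, 7}" "ends (petersen n) (13 + 5 * j) = {3, 8}"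
    "ends (petersen n) (14 + 5 * j) = {4, 9}"
    by (simp_all add: petersen_def)
qed (simp_all add: petersen_def numeral_2_eq_2)

lemma sum_petersen_edges:
  fixes h :: "nat \<Rightarrow> nat"
  shows "(\<Sum>e\<in>edges (petersen n). h e) =
    h 0 + h 1 + h 2 + h 3 + h 4 + (h 5 + h 6 + h 7 + h 8 + h 9) +
    (\<Sum>j<n. h (10 + 5 * j) + h (11 + 5 * j) + h (12 + 5 * j) + h (13 + 5 * j) + h (14 + 5 * j))"
proof (induction n)
  case 0
  show ?case by (simp add: petersen_def eval_nat_numeral)
next
  case (Suc n)
  have "{..<10 + 5 * Suc n} =
      insert (14 + 5 * n) (insert (13 + 5 * n) (insert (12 + 5 * n) (insert (11 + 5 * n)
        (insert (10 + 5 * n) {..<10 + 5 * n}))))" by auto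
  with Suc show ?case by (simp add: petersen_simps)
qed

lemma graph_petersen: "graph (petersen n)"
proof -
  have "ends (petersen n) e \<subseteq> {..<10} \<and> card (ends (petersen n) e) = 2" for e
  proof -
    consider "e < 5" | "5 \<le> e" "e < 10" | "10 \<le> e" by linarith
    then show ?thesis
    proof cases
      case 1
      then have "e = 0 \<or> e = 1 \<or> e = 2 \<or> e = 3 \<or> e = 4" by auto
      then show ?thesis by (elim disjE) (simp_all add: petersen_def)
    next
      case 2
      then have "e = 5 \<or> e = 6 \<or> e = 7 \<or> e = 8 \<or> e = 9" by auto
      then show ?thesis by (elim disjE) (simp_all add: petersen_def)
    next
      case 3
      have "e mod 5 < 5" by simp
      then have "e mod 5 < 10" "5 + e mod 5 < 10" "e mod 5 \<noteq> 5 + e mod 5" by linarith+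
      with 3 show ?thesis by (simp add: petersen_def)
    qed
  qed
  then show ?thesis by (simp add: graph_def petersen_simps)
qed

lemma card_boundary_petersen:
  "card (boundary (petersen n) X) =
    of_bool ((0 \<in> X) \<noteq> (1 \<in> X)) + of_bool ((1 \<in> X) \<noteq> (2 \<in> X)) + of_bool ((2 \<in> X) \<noteq> (3 \<in> X)) +
    of_bool ((3 \<in> X) \<noteq> (4 \<in> X)) + of_bool ((4 \<in> X) \<noteq> (0 \<in> X)) +
    (of_bool ((5 \<in> X) \<noteq> (7 \<in> X)) + of_bool ((6 \<in> X) \<noteq> (8 \<in> X)) + of_bool ((7 \<in> X) \<noteq> (9 \<in> X)) +
    of_bool ((8 \<in> X) \<noteq> (5 \<in> X)) + of_bool ((9 \<in> X) \<noteq> (6 \<in> X))) +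
    n * (of_bool ((0 \<in> X) \<noteq> (5 \<in> X)) + of_bool ((1 \<in> X) \<noteq> (6 \<in> X)) + of_bool ((2 \<in> X) \<noteq> (7 \<in> X)) +
    of_bool ((3 \<in> X) \<noteq> (8 \<in> X)) + of_bool ((4 \<in> X) \<noteq> (9 \<in> X)))"
  unfolding card_boundary_sum[OF graph_petersen] sum_petersen_edges petersen_ends
  by (simp only: pair_cut_iff zero_neq_one one_neq_zero numeral_eq_iff num.distinct num.inject
      zero_neq_numeral one_eq_numeral_iff numeral_eq_one_iff numeral_neq_zero not_False_eq_True
      sum_constant card_lessThan of_nat_id)

lemma pentagon_cut:
  "(P0 \<longleftrightarrow> P1) \<and> (P1 \<longleftrightarrow> P2) \<and> (P2 \<longleftrightarrow> P3) \<and> (P3 \<longleftrightarrow> P4) \<or>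
   (2 :: nat) \<le> of_bool (P0 \<noteq> P1) + of_bool (P1 \<noteq> P2) + of_bool (P2 \<noteq> P3) + of_bool (P3 \<noteq> P4) + of_bool (P4 \<noteq> P0)"
  by (cases P0; cases P1; cases P2; cases P3; cases P4) simp_all

text \<open>An odd set splits an odd number of spokes. It also cuts one of the two pentagons at least
  twice, unless it is one of them and so splits all spokes.\<close>

lemma r_graph_petersen:
  assumes "0 < n"
  shows "r_graph (n + 2) (petersen n)"
proof -
  have "card (boundary (petersen n) {v}) = n + 2" if "v < 10" for v
  proof -
    have "v = 0 \<or> v = 1 \<or> v = 2 \<or> v = 3 \<or> v = 4 \<or> v = 5 \<or> v = 6 \<or> v = 7 \<or> v = 8 \<or> v = 9"
      using that by auto
    then show ?thesis unfolding card_boundary_petersen by (elim disjE) simp_all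
  qed
  moreover have "n + 2 \<le> card (boundary (petersen n) X)" if X: "X \<subseteq> {..<10}" "odd (card X)" for X
  proof -
    define s :: nat where "s = of_bool ((0 \<in> X) \<noteq> (5 \<in> X)) + of_bool ((1 \<in> X) \<noteq> (6 \<in> X)) +
      of_bool ((2 \<in> X) \<noteq> (7 \<in> X)) + of_bool ((3 \<in> X) \<noteq> (8 \<in> X)) + of_bool ((4 \<in> X) \<noteq> (9 \<in> X))"
    have "card X = (\<Sum>v<10. of_bool (v \<in> X))"
      using X(1) by (simp add: Int_absorb1)
    also have "\<dots> = (of_bool (0 \<in> X) + of_bool (5 \<in> X)) + (of_bool (1 \<in> X) + of_bool (6 \<in> X)) +
      (of_bool (2 \<in> X) + of_bool (7 \<in> X)) + (of_bool (3 \<in> X) + of_bool (8 \<in> X)) +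
      (of_bool (4 \<in> X) + of_bool (9 \<in> X))"
      by (simp add: eval_nat_numeral)
    finally have cardX: "card X = \<dots>" .
    have parity: "of_bool P + of_bool Q = of_bool (P \<noteq> Q) + 2 * (of_bool (P \<and> Q) :: nat)" for P Q
      by (cases P; cases Q) simp_all
    have "odd s"
      unfolding s_def using X(2)[unfolded cardX parity]
      by (simp only: even_add even_mult_iff even_numeral simp_thms)
    then have "1 \<le> s" by (cases s) auto
    show ?thesis
    proof (cases "((0 \<in> X) = (1 \<in> X) \<and> (1 \<in> X) = (2 \<in> X) \<and> (2 \<in> X) = (3 \<in> X) \<and> (3 \<in> X) = (4 \<in> X)) \<and>
        ((5 \<in> X) = (7 \<in> X) \<and> (7 \<in> X) = (9 \<in> X) \<and> (9 \<in> X) = (6 \<in> X) \<and> (6 \<in> X) = (8 \<in> X))")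
      case True
      then have "s = 5 * of_bool ((0 \<in> X) \<noteq> (5 \<in> X))" by (simp add: s_def)
      with \<open>odd s\<close> have "s = 5" by (simp split: if_splits)
      then have "n + 2 \<le> n * s" using assms by simp
      then show ?thesis unfolding card_boundary_petersen s_def by linarith
    next
      case False
      have "n \<le> n * s" using \<open>1 \<le> s\<close> by simp
      moreover have "2 \<le> of_bool ((0 \<in> X) \<noteq> (1 \<in> X)) + of_bool ((1 \<in> X) \<noteq> (2 \<in> X)) +
          of_bool ((2 \<in> X) \<noteq> (3 \<in> X)) + of_bool ((3 \<in> X) \<noteq> (4 \<in> X)) + (of_bool ((4 \<in> X) \<noteq> (0 \<in> X)) :: nat) \<or>
        2 \<le> of_bool ((5 \<in> X) \<noteq> (7 \<in> X)) + of_bool ((7 \<in> X) \<noteq> (9 \<in> X)) +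
          of_bool ((9 \<in> X) \<noteq> (6 \<in> X)) + of_bool ((6 \<in> X) \<noteq> (8 \<in> X)) + (of_bool ((8 \<in> X) \<noteq> (5 \<in> X)) :: nat)"
        using False pentagon_cut[of "0 \<in> X" "1 \<in> X" "2 \<in> X" "3 \<in> X" "4 \<in> X"]
          pentagon_cut[of "5 \<in> X" "7 \<in> X" "9 \<in> X" "6 \<in> X" "8 \<in> X"] by blast
      ultimately show ?thesis unfolding card_boundary_petersen s_def by linarith
    qed
  qed
  ultimately show ?thesis
    using graph_petersen by (simp add: r_graph_def regular_graph_def petersen_simps)
qed

lemma connected_petersen:
  assumes "0 < n"
  shows "connected_graph (petersen n)"
proof -
  let ?A = "adjacency (petersen n)"
  have adj: "(u, v) \<in> ?A" if "e < 15" "ends (petersen n) e = {u, v}" for e u v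
    using that assms by (auto simp: adjacency_def petersen_simps intro!: bexI[of _ e])
  have spokes: "(0, 5) \<in> ?A" "(1, 6) \<in> ?A" "(2, 7) \<in> ?A" "(3, 8) \<in> ?A" "(4, 9) \<in> ?A"
    using petersen_ends(11-15)[of n 0]
    by (auto intro: adj[of 10] adj[of 11] adj[of 12] adj[of 13] adj[of 14])
  have outer: "(0, 1) \<in> ?A" "(1, 2) \<in> ?A" "(2, 3) \<in> ?A" "(3, 4) \<in> ?A"
    using petersen_ends(1-4)[of n] by (auto intro: adj[of 0] adj[of 1] adj[of 2] adj[of 3])
  have r: "(0, 1) \<in> ?A\<^sup>*" "(0, 2) \<in> ?A\<^sup>*" "(0, 3) \<in> ?A\<^sup>*" "(0, 4) \<in> ?A\<^sup>*"
    using outer by (meson r_into_rtrancl rtrancl.rtrancl_into_rtrancl)+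
  have r': "(0, 5) \<in> ?A\<^sup>*" "(0, 6) \<in> ?A\<^sup>*" "(0, 7) \<in> ?A\<^sup>*" "(0, 8) \<in> ?A\<^sup>*" "(0, 9) \<in> ?A\<^sup>*"
    using spokes r by (meson r_into_rtrancl rtrancl.rtrancl_into_rtrancl)+
  have "(0, v) \<in> ?A\<^sup>*" if "v < 10" for v
  proof -
    have "v = 0 \<or> v = 1 \<or> v = 2 \<or> v = 3 \<or> v = 4 \<or> v = 5 \<or> v = 6 \<or> v = 7 \<or> v = 8 \<or> v = 9"
      using that by auto
    then show ?thesis using r r' by (elim disjE) simp_all
  qed
  then have "(u, v) \<in> ?A\<^sup>*" if "u < 10" "v < 10" for u v
    using that by (meson adjacency_rtrancl_sym rtrancl_trans)
  moreover have "(0 :: nat) \<in> {..<10}" by simp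
  ultimately show ?thesis unfolding connected_graph_def petersen_simps by blast
qed

text \<open>A 5-cycle with edges \<open>a0, \<dots>, a4\<close> and one pendant spoke \<open>ti\<close> at each vertex: the variables
  are the multiplicities in a set that covers every vertex of the cycle once. Apart from one or
  five spokes, only three spokes next to a single cycle edge are possible.\<close>

lemma pentagon_matching:
  fixes a0 a1 a2 a3 a4 t0 t1 t2 t3 t4 :: nat
  assumes "a0 + a4 + t0 = 1" "a1 + a0 + t1 = 1" "a2 + a1 + t2 = 1" "a3 + a2 + t3 = 1" "a4 + a3 + t4 = 1"
  shows "t0 + t1 + t2 + t3 + t4 = 1 \<or> t0 + t1 + t2 + t3 + t4 = 5 \<or>
    (t0 = 0 \<and> t1 = 0 \<and> t2 = 1 \<and> t3 = 1 \<and> t4 = 1) \<or> (t0 = 1 \<and> t1 = 0 \<and> t2 = 0 \<and> t3 = 1 \<and> t4 = 1) \<or>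
    (t0 = 1 \<and> t1 = 1 \<and> t2 = 0 \<and> t3 = 0 \<and> t4 = 1) \<or> (t0 = 1 \<and> t1 = 1 \<and> t2 = 1 \<and> t3 = 0 \<and> t4 = 0) \<or>
    (t0 = 0 \<and> t1 = 1 \<and> t2 = 1 \<and> t3 = 1 \<and> t4 = 0)"
proof -
  have "a0 = 0 \<or> a0 = 1" "a1 = 0 \<or> a1 = 1" "a2 = 0 \<or> a2 = 1" "a3 = 0 \<or> a3 = 1" "a4 = 0 \<or> a4 = 1"
    using assms by linarith+
  then show ?thesis using assms by (elim disjE) simp_all
qed

text \<open>The crossing number of a perfect matching is odd. Three spokes would leave two consecutive
  vertices of the outer cycle and the corresponding two inner vertices, which are not adjacent.\<close>

lemma petersen_matching_spokes:
  fixes M :: "nat set"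
  assumes "\<And>v. v < 10 \<Longrightarrow> (\<Sum>e\<in>edges (petersen n). of_bool (v \<in> ends (petersen n) e \<and> e \<in> M)) = (1 :: nat)"
  shows "\<exists>k. (\<Sum>j<n. of_bool (10 + 5 * j \<in> M) + of_bool (11 + 5 * j \<in> M) + of_bool (12 + 5 * j \<in> M) +
    of_bool (13 + 5 * j \<in> M) + of_bool (14 + 5 * j \<in> M)) = 1 + 4 * (k :: nat)"
proof -
  define t where "t i = (\<Sum>j<n. of_bool (i + 5 * j \<in> M) :: nat)" for i
  define m where "m e = (of_bool (e \<in> M) :: nat)" for e
  have star: "(\<Sum>e\<in>edges (petersen n). of_bool (v \<in> ends (petersen n) e \<and> e \<in> M)) = (1 :: nat)"
    if "v < 10" for v using assms that by simp
  have v: "m 0 + m 4 + t 10 = 1" "m 1 + m 0 + t 11 = 1" "m 2 + m 1 + t 12 = 1"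
    "m 3 + m 2 + t 13 = 1" "m 4 + m 3 + t 14 = 1"
    "m 5 + m 8 + t 10 = 1" "m 6 + m 9 + t 11 = 1" "m 7 + m 5 + t 12 = 1"
    "m 8 + m 6 + t 13 = 1" "m 9 + m 7 + t 14 = 1"
    using star[of 0] star[of 1] star[of 2] star[of 3] star[of 4]
      star[of 5] star[of 6] star[of 7] star[of 8] star[of 9]
    unfolding sum_petersen_edges petersen_ends t_def m_def
    by (simp_all only: insert_iff empty_iff zero_neq_one one_neq_zero numeral_eq_iff num.distinct
        num.inject zero_neq_numeral one_eq_numeral_iff numeral_eq_one_iff numeral_neq_zero simp_thms
        of_bool_eq add_0_left add_0_right zero_less_numeral one_less_numeral_iff numeral_less_iff
        semiring_norm zero_less_one add_ac)
  have "t 10 + t 11 + t 12 + t 13 + t 14 = 1 \<or> t 10 + t 11 + t 12 + t 13 + t 14 = 5"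
    \<comment> \<open>The pentagram visits the inner vertices in the order \<open>5, 7, 9, 6, 8\<close>.\<close>
    using pentagon_matching[OF v(1-5)] pentagon_matching[OF v(6,8,10,7,9)]
    by (elim disjE conjE) simp_all
  then have "\<exists>k. t 10 + t 11 + t 12 + t 13 + t 14 = 1 + 4 * k" by presburger
  then show ?thesis by (simp add: t_def sum.distrib)
qed

lemma boundary_two_vertices:
  assumes "graph K" "card (verts K) = 2" "u \<in> verts K"
  shows "boundary K {u} = edges K"
proof -
  have "ends K e = verts K" if "e \<in> edges K" for e
    using assms that card_subset_eq[of "verts K" "ends K e"] by (simp add: graph_def)
  with assms(3) show ?thesis by (auto simp: boundary_singleton)
qed

text \<open>A two-vertex graph provides just \<open>n + 2\<close> colors, and each color class would be a perfect
  matching with \<open>1\<close> or \<open>5\<close> spokes. Modulo \<open>4\<close> they contain \<open>n + 2\<close> spokes, but there are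
  \<open>5 * n\<close>.\<close>

lemma petersen_not_colored_by_two_vertices:
  assumes K: "r_graph (n + 2) K" "card (verts K) = 2"
  shows "\<not> colors K (petersen n)"
proof
  assume "colors K (petersen n)"
  then obtain f \<phi> where f: "local_bijection (petersen n) K f \<phi>"
    using graph_petersen by (auto simp: colors_iff_local_bijection)
  note Kg = r_graphD(1)[OF K(1)]
  define C where "C = edges K"
  have fin: "finite C" using Kg by (simp add: C_def graph_def)
  have bij: "bij_betw f (boundary (petersen n) {v}) C" if "v < 10" for v
  proof -
    have "\<phi> v \<in> verts K" "bij_betw f (boundary (petersen n) {v}) (boundary K {\<phi> v})"
      using f that by (simp_all add: local_bijection_def petersen_simps)
    then show ?thesis using boundary_two_vertices[OF Kg K(2)] by (simp add: C_def)
  qed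
  obtain u where "u \<in> verts K" using K(2) by fastforce
  then have "card C = n + 2"
    using boundary_two_vertices[OF Kg K(2)] r_graphD(2)[OF K(1)] by (metis C_def)
  let ?s = "\<lambda>c j. of_bool (f (10 + 5 * j) = c) + of_bool (f (11 + 5 * j) = c) + of_bool (f (12 + 5 * j) = c) +
      of_bool (f (13 + 5 * j) = c) + of_bool (f (14 + 5 * j) = c) :: nat"
  have "\<forall>c\<in>C. \<exists>k. (\<Sum>j<n. ?s c j) = 1 + 4 * k"
  proof
    fix c assume c: "c \<in> C"
    have "(\<Sum>e\<in>edges (petersen n). of_bool (v \<in> ends (petersen n) e \<and> e \<in> {e. f e = c})) = (1 :: nat)"
      if "v < 10" for v
    proof -
      obtain e where e: "e \<in> boundary (petersen n) {v}" "f e = c"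
        using bij[OF \<open>v < 10\<close>] c by (auto simp: bij_betw_def)
      then have "{e \<in> edges (petersen n). v \<in> ends (petersen n) e \<and> f e = c} = {e}"
        using bij[OF \<open>v < 10\<close>] by (auto simp: boundary_singleton bij_betw_def inj_on_def)
      moreover have "finite (edges (petersen n))" by (simp add: petersen_simps)
      ultimately show ?thesis by (simp add: Int_def)
    qed
    from petersen_matching_spokes[OF this] show "\<exists>k. (\<Sum>j<n. ?s c j) = 1 + 4 * k"
      by (simp only: mem_Collect_eq)
  qed
  from bchoice[OF this] obtain k where k: "\<forall>c\<in>C. (\<Sum>j<n. ?s c j) = 1 + 4 * k c" ..
  have one: "(\<Sum>c\<in>C. of_bool (f e = c)) = (1 :: nat)" if "e < 10 + 5 * n" for e
  proof -
    have "f e \<in> C"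
      using local_bijection_edge(1)[OF graph_petersen f] that by (simp add: C_def petersen_simps)
    then have "C \<inter> {c. f e = c} = {f e}" by auto
    then show ?thesis using fin by simp
  qed
  have "(\<Sum>c\<in>C. \<Sum>j<n. ?s c j) = (\<Sum>j<n. \<Sum>c\<in>C. ?s c j)" by (rule sum.swap)
  also have "\<dots> = (\<Sum>j<n. 5)"
    by (intro sum.cong) (simp_all add: sum.distrib one del: sum_of_bool_eq)
  also have "(\<Sum>c\<in>C. \<Sum>j<n. ?s c j) = (\<Sum>c\<in>C. 1 + 4 * k c)"
    using k by (intro sum.cong) simp_all
  also have "\<dots> = n + 2 + 4 * sum k C"
    unfolding sum.distrib sum_distrib_left[symmetric] using \<open>card C = n + 2\<close> by simp
  finally have "n + 2 + 4 * sum k C = 5 * n" by simp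
  then show False by presburger
qed

section \<open>Representatives of the core graphs\<close>

lemma isomorphic_refl: "isomorphic G G"
  unfolding isomorphic_def by (rule exI[of _ id], rule exI[of _ id]) simp

lemma isomorphic_sym:
  assumes G: "graph G" and "isomorphic G H"
  shows "isomorphic H G"
proof -
  obtain \<alpha> \<beta> where \<alpha>: "bij_betw \<alpha> (verts G) (verts H)" and \<beta>: "bij_betw \<beta> (edges G) (edges H)"
    and ends: "\<And>e. e \<in> edges G \<Longrightarrow> ends H (\<beta> e) = \<alpha> ` ends G e"
    using assms(2) by (auto simp: isomorphic_def)
  let ?a = "inv_into (verts G) \<alpha>" and ?b = "inv_into (edges G) \<beta>"
  have "ends G (?b d) = ?a ` ends H d" if d: "d \<in> edges H" for d
  proof -
    have b: "?b d \<in> edges G" "\<beta> (?b d) = d"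
      using \<beta> d by (auto simp: bij_betw_def inv_into_into f_inv_into_f)
    then have "ends H d = \<alpha> ` ends G (?b d)" using ends by metis
    moreover have "ends G (?b d) \<subseteq> verts G" using G b by (auto simp: graph_def)
    ultimately show ?thesis using \<alpha> by (simp add: bij_betw_def inv_into_image_cancel)
  qed
  then show ?thesis
    unfolding isomorphic_def using bij_betw_inv_into[OF \<alpha>] bij_betw_inv_into[OF \<beta>] by blast
qed

lemma isomorphic_trans:
  assumes "isomorphic G H" "isomorphic H K"
  shows "isomorphic G K"
proof -
  obtain \<alpha> \<beta> where 1: "bij_betw \<alpha> (verts G) (verts H)" "bij_betw \<beta> (edges G) (edges H)"
    "\<forall>e\<in>edges G. ends H (\<beta> e) = \<alpha> ` ends G e" using assms(1) by (auto simp: isomorphic_def)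
  obtain \<alpha>' \<beta>' where 2: "bij_betw \<alpha>' (verts H) (verts K)" "bij_betw \<beta>' (edges H) (edges K)"
    "\<forall>e\<in>edges H. ends K (\<beta>' e) = \<alpha>' ` ends H e" using assms(2) by (auto simp: isomorphic_def)
  have "\<forall>e\<in>edges G. ends K ((\<beta>' \<circ> \<beta>) e) = (\<alpha>' \<circ> \<alpha>) ` ends G e"
    using 1 2 bij_betwE[OF 1(2)] by (simp add: image_comp)
  then show ?thesis
    unfolding isomorphic_def using bij_betw_trans[OF 1(1) 2(1)] bij_betw_trans[OF 1(2) 2(2)] by blast
qed

lemma colors_if_isomorphic:
  assumes G: "graph G" and "isomorphic G H"
  shows "colors H G"
proof -
  obtain \<alpha> \<beta> where \<alpha>: "bij_betw \<alpha> (verts G) (verts H)" and \<beta>: "bij_betw \<beta> (edges G) (edges H)"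
    and ends: "\<And>e. e \<in> edges G \<Longrightarrow> ends H (\<beta> e) = \<alpha> ` ends G e"
    using assms(2) by (auto simp: isomorphic_def)
  have "local_bijection G H \<beta> \<alpha>"
    unfolding local_bijection_def
  proof (intro ballI conjI)
    fix v assume v: "v \<in> verts G"
    then show "\<alpha> v \<in> verts H" using \<alpha> by (auto simp: bij_betw_def)
    have iff: "\<alpha> v \<in> ends H (\<beta> e) \<longleftrightarrow> v \<in> ends G e" if "e \<in> edges G" for e
    proof -
      have "ends G e \<subseteq> verts G" using G that by (auto simp: graph_def)
      then show ?thesis
        using \<alpha> v ends[OF that] inj_on_image_mem_iff[of \<alpha> "verts G" v "ends G e"]
        by (simp add: bij_betw_def)
    qed
    have "boundary H {\<alpha> v} = \<beta> ` boundary G {v}"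
    proof -
      have "edges H = \<beta> ` edges G" using \<beta> by (simp add: bij_betw_def)
      then show ?thesis using iff by (auto simp: boundary_singleton)
    qed
    then show "bij_betw \<beta> (boundary G {v}) (boundary H {\<alpha> v})"
      using bij_betw_subset[OF \<beta> boundary_subset_edges] by blast
  qed
  then show ?thesis using G by (auto simp: colors_iff_local_bijection)
qed

lemma two_le_card_verts:
  assumes "0 < r" "r_graph r G" "connected_graph G"
  shows "2 \<le> card (verts G)"
proof -
  note G = r_graphD(1)[OF assms(2)]
  obtain v where "v \<in> verts G" using assms(3) by (auto simp: connected_graph_def)
  then have "boundary G {v} \<noteq> {}" using r_graphD(2)[OF assms(2)] assms(1) by fastforce
  then obtain e where "e \<in> edges G" using boundary_subset_edges[of G "{v}"] by blast
  then have "ends G e \<subseteq> verts G" "card (ends G e) = 2" "finite (verts G)"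
    using G by (auto simp: graph_def)
  then show ?thesis by (metis card_mono)
qed

text \<open>All edges of a two-vertex graph are adjacent, so they can be mapped to any star.\<close>

lemma two_vertices_colored_by_all:
  assumes G: "r_graph r G" "card (verts G) = 2" and H: "r_graph r H" "connected_graph H"
  shows "colors H G"
proof -
  note Gg = r_graphD(1)[OF G(1)] and Hg = r_graphD(1)[OF H(1)]
  obtain u where u: "u \<in> verts H" using H(2) by (auto simp: connected_graph_def)
  obtain v where v: "v \<in> verts G" using G(2) by fastforce
  have bd: "boundary G {w} = edges G" if "w \<in> verts G" for w
    using boundary_two_vertices[OF Gg G(2) that] .
  have "card (edges G) = card (boundary H {u})"
    using bd[OF v] r_graphD(2)[OF G(1) v] r_graphD(2)[OF H(1) u] by simp
  moreover have "finite (edges G)" using Gg by (simp add: graph_def)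
  ultimately obtain f where "bij_betw f (edges G) (boundary H {u})"
    using finite_same_card_bij finite_boundary[OF Hg] by metis
  then have "local_bijection G H f (\<lambda>_. u)" using u bd by (simp add: local_bijection_def)
  then show ?thesis using Gg by (auto simp: colors_iff_local_bijection)
qed

lemma ex_smallest_coloring_graph:
  fixes G :: nat_graph
  assumes G: "connected_graph G" "r_graph r G"
  obtains M :: nat_graph where "connected_graph M" "r_graph r M" "colors M G"
    "\<And>H :: nat_graph. connected_graph H \<Longrightarrow> r_graph r H \<Longrightarrow> colors H M \<Longrightarrow> card (verts M) \<le> card (verts H)"
proof -
  note Gg = r_graphD(1)[OF G(2)]
  let ?P = "\<lambda>M :: nat_graph. connected_graph M \<and> r_graph r M \<and> colors M G"
  have "?P G" using G colors_refl[OF Gg] by simp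
  then obtain M where M: "?P M" and min: "\<And>H. ?P H \<Longrightarrow> card (verts M) \<le> card (verts H)"
    using ex_has_least_nat[of ?P G "\<lambda>M. card (verts M)"] by blast
  show thesis
  proof (rule that)
    fix H :: nat_graph
    assume H: "connected_graph H" "r_graph r H" "colors H M"
    then have "colors H G"
      using colors_trans[OF Gg, of M H] M r_graphD(1) by blast
    with H min show "card (verts M) \<le> card (verts H)" by simp
  qed (use M in simp_all)
qed

text \<open>A smallest graph coloring \<open>G\<close> is a core unless it has two vertices. In that case every graph
  colors \<open>G\<close>, in particular a smallest one coloring the Petersen graph with multiplied spokes.\<close>

lemma ex_core_coloring:
  fixes G :: nat_graph
  assumes r: "3 \<le> r" and G: "connected_graph G" "r_graph r G"
  shows "\<exists>M. core_graph r M \<and> colors M G"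
proof -
  obtain M :: nat_graph where M: "connected_graph M" "r_graph r M" "colors M G"
    and minM: "\<And>H :: nat_graph. connected_graph H \<Longrightarrow> r_graph r H \<Longrightarrow> colors H M \<Longrightarrow>
      card (verts M) \<le> card (verts H)"
    using ex_smallest_coloring_graph[OF G] by blast
  show ?thesis
  proof (cases "card (verts M) = 2")
    case False
    then have "core_graph r M"
      using M minM two_le_card_verts[of r M] r by (simp add: core_graph_def)
    with M show ?thesis by blast
  next
    case True
    define n where "n = r - 2"
    have n: "0 < n" "r = n + 2" using r by (simp_all add: n_def)
    note P = connected_petersen[OF n(1)] r_graph_petersen[OF n(1), folded n(2)]
    obtain N :: nat_graph where N: "connected_graph N" "r_graph r N" "colors N (petersen n)"
      and minN: "\<And>H :: nat_graph. connected_graph H \<Longrightarrow> r_graph r H \<Longrightarrow> colors H N \<Longrightarrow>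
        card (verts N) \<le> card (verts H)"
      using ex_smallest_coloring_graph[OF P] by blast
    have "card (verts N) \<noteq> 2"
      using petersen_not_colored_by_two_vertices[of n N] N n by blast
    then have "core_graph r N"
      using N minN two_le_card_verts[of r N] r by (simp add: core_graph_def)
    moreover have "colors N M"
      using two_vertices_colored_by_all[OF M(2) True N(2,1)] .
    then have "colors N G"
      using colors_trans[OF r_graphD(1)[OF G(2)] r_graphD(1)[OF M(2)] M(3)] by blast
    ultimately show ?thesis by blast
  qed
qed

theorem corollary3p8:
  fixes r :: nat
  assumes "r \<ge> 3"
  shows "\<exists>\<A>. minimal_r_complete r \<A> \<and>
           (\<forall>\<B>. minimal_r_complete r \<B> \<longrightarrow> same_up_to_iso \<A> \<B>)"
proof -
  have core: "connected_graph M" "r_graph r M" "graph M" if "core_graph r M" for M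
    using that r_graphD(1) by (auto simp: core_graph_def)
  have rigid: "isomorphic M H"
    if "core_graph r M" "connected_graph H" "r_graph r H" "colors H M" for M H :: nat_graph
    using isomorphic_if_colors_core[OF _ that] assms by simp
  \<comment> \<open>Isomorphic cores satisfy the same choice predicate, so they get the same representative.\<close>
  define rep where "rep M = (SOME H. core_graph r H \<and> isomorphic M H)" for M :: nat_graph
  define \<A> where "\<A> = rep ` {M. core_graph r M}"
  have rep: "core_graph r (rep M)" "isomorphic M (rep M)" if "core_graph r M" for M
    using someI[of "\<lambda>H. core_graph r H \<and> isomorphic M H" M] that isomorphic_refl[of M]
    by (simp_all add: rep_def)
  have \<A>_core: "core_graph r G" if "G \<in> \<A>" for G using that rep by (auto simp: \<A>_def)
  have \<A>_unique: "G = H" if "G \<in> \<A>" "H \<in> \<A>" "isomorphic G H" for G H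
  proof -
    obtain M N where M: "core_graph r M" "G = rep M" and N: "core_graph r N" "H = rep N"
      using \<open>G \<in> \<A>\<close> \<open>H \<in> \<A>\<close> by (auto simp: \<A>_def)
    have "isomorphic (rep N) N" using isomorphic_sym[OF core(3)] rep N(1) by blast
    then have "isomorphic M N" using rep[OF M(1)] that(3) M(2) N(2) isomorphic_trans by blast
    moreover from this have "isomorphic N M" using isomorphic_sym[OF core(3)] M(1) by blast
    ultimately have "isomorphic M K \<longleftrightarrow> isomorphic N K" for K :: nat_graph
      using isomorphic_trans by blast
    then show ?thesis by (simp add: M(2) N(2) rep_def)
  qed
  have \<A>_colors: "\<exists>H\<in>\<A>. colors H G" if G: "connected_graph G" "r_graph r G" for G :: nat_graph
  proof -
    obtain M where M: "core_graph r M" "colors M G" using ex_core_coloring[OF assms G] by blast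
    have "colors (rep M) M" using colors_if_isomorphic[OF core(3)] rep M(1) by blast
    then have "colors (rep M) G"
      using colors_trans[OF r_graphD(1)[OF G(2)] core(3)[OF M(1)] M(2)] by blast
    with M(1) show ?thesis by (auto simp: \<A>_def)
  qed
  then have \<A>_complete: "r_complete r \<A>"
    using \<A>_core core by (auto simp: r_complete_def)
  have "\<not> r_complete r \<B>" if "\<B> \<subset> \<A>" for \<B>
  proof
    assume \<B>: "r_complete r \<B>"
    obtain G where G: "G \<in> \<A>" "G \<notin> \<B>" using \<open>\<B> \<subset> \<A>\<close> by blast
    then obtain H where H: "H \<in> \<B>" "colors H G"
      using \<B> core \<A>_core by (meson r_complete_def)
    then have "isomorphic G H"
      using rigid[OF \<A>_core[OF G(1)], of H] \<B> by (auto simp: r_complete_def)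
    then have "G = H" using \<A>_unique[OF G(1)] H(1) that by blast
    with G H show False by simp
  qed
  with \<A>_complete have "minimal_r_complete r \<A>" by (auto simp: minimal_r_complete_def)
  moreover have "same_up_to_iso \<A> \<B>" if min: "minimal_r_complete r \<B>" for \<B>
  proof -
    have \<B>: "r_complete r \<B>" and minimal: "\<And>\<C>. \<C> \<subset> \<B> \<Longrightarrow> \<not> r_complete r \<C>"
      using min by (auto simp: minimal_r_complete_def)
    \<comment> \<open>Rigidity turns the members of \<open>\<B>\<close> that color the cores into copies of them. These copies
      already form a complete set, so by minimality they exhaust \<open>\<B>\<close>.\<close>
    have "\<exists>H. H \<in> \<B> \<and> colors H G" if "G \<in> \<A>" for G
      using \<B> core \<A>_core[OF that] unfolding r_complete_def by blast
    then obtain \<psi> where \<psi>: "\<And>G. G \<in> \<A> \<Longrightarrow> \<psi> G \<in> \<B>" "\<And>G. G \<in> \<A> \<Longrightarrow> colors (\<psi> G) G"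
      by metis
    have iso: "isomorphic G (\<psi> G)" if "G \<in> \<A>" for G
      using rigid[OF \<A>_core[OF that]] \<psi>[OF that] \<B> by (simp add: r_complete_def)
    have "inj_on \<psi> \<A>"
    proof (rule inj_onI)
      fix G H assume GH: "G \<in> \<A>" "H \<in> \<A>" "\<psi> G = \<psi> H"
      have "isomorphic (\<psi> H) H" using isomorphic_sym[OF core(3)[OF \<A>_core]] iso GH(2) by blast
      then have "isomorphic G H" using iso[OF GH(1)] GH(3) isomorphic_trans by metis
      with \<A>_unique GH show "G = H" by blast
    qed
    moreover have "r_complete r (\<psi> ` \<A>)"
      unfolding r_complete_def
    proof (intro conjI ballI allI impI)
      fix H assume "H \<in> \<psi> ` \<A>"
      then have "H \<in> \<B>" using \<psi>(1) by blast
      then show "connected_graph H" "r_graph r H" using \<B> by (auto simp: r_complete_def)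
    next
      fix G :: nat_graph assume G: "connected_graph G \<and> r_graph r G"
      then obtain H where H: "H \<in> \<A>" "colors H G" using \<A>_colors by blast
      then have "colors (\<psi> H) G"
        using colors_trans[of G H "\<psi> H"] r_graphD(1) G core(3)[OF \<A>_core] \<psi>(2) by blast
      with H show "\<exists>H\<in>\<psi> ` \<A>. colors H G" by blast
    qed
    then have "\<psi> ` \<A> = \<B>" using minimal \<psi>(1) by blast
    ultimately show ?thesis
      unfolding same_up_to_iso_def bij_betw_def using iso by blast
  qed
  ultimately show ?thesis by blast
qed
end
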